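(* The values of the isotopy invariants $\Theta_{d,D}$ for classical links depend only on the cardinality $|D|$ of $D$; hence, for a fixed $d$, only $d$ invariants are obtained. Further, for positive integers $d\le d'$ and non-empty subsets $D\subseteq\mathbb{Z}/d\mathbb{Z}$, $D'\subseteq\mathbb{Z}/d'\mathbb{Z}$ with $|D|=|D'|$, one has $\Theta_{d,D}=\Theta_{d',D'}$. In particular, if $|D'|=d$, then $\Theta_{d',D'}=\Theta_{d,\mathbb{Z}/d\mathbb{Z}}$. Therefore the invariants $\Theta_{d,D}$ can be parametrized by the positive integers, setting $\Theta_d:=\Theta_{d,\mathbb{Z}/d\mathbb{Z}}$ for all $d\in\mathbb{Z}_{>0}$.
   Context: Let $B_n$ be the braid group on $n$ strands with standard generators $\sigma_1,\dots,\sigma_{n-1}$, and let $q\in\mathbb{C}\setminus\{0\}$. The Yokonuma--Hecke algebra $Y_{d,n}(q)$ is the $\mathbb{C}$-algebra generated by $g_1,\dots,g_{n-1},t_1,\dots,t_n$ with relations: $g_ig_jg_i=g_jg_ig_j$ for $|i-j|=1$; $g_ig_j=g_jg_i$ for $|i-j|>1$; $t_it_j=t_jt_i$; $t_jg_i=g_it_{s_i(j)}$ where $s_i=(i,i+1)$; $t_j^d=1$; and $g_i^2=1+(q-q^{-1})e_ig_i$, where $e_i=\frac1d\sum_{s=0}^{d-1}t_i^st_{i+1}^{d-s}$. Set $Y_{d,0}(q)=\mathbb{C}$; there are natural inclusions $Y_{d,n}(q)\subset Y_{d,n+1}(q)$. For a non-empty $D\subseteq\mathbb{Z}/d\mathbb{Z}$,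 let $X_D=(\mathrm{x}_1,\dots,\mathrm{x}_{d-1})$ be the solution of the E-system $\sum_{s=0}^{d-1}x_{k+s}x_{d-s}=x_k\sum_{s=0}^{d-1}x_sx_{d-s}$ ($1\le k\le d-1$, indices modulo $d$, $x_0=1$) parametrized by $D$, namely $\mathrm{x}_k=\frac{1}{|D|}\sum_{m\in D}\exp(2\pi\sqrt{-1}\,km/d)$. Let $z$ be an indeterminate. The specialized trace $\mathrm{tr}_{d,D}:\bigcup_{n\ge0}Y_{d,n}(q)\to\mathbb{C}[z]$ is the unique linear map with, for all $n$ and all $a,b\in Y_{d,n}(q)$: $\mathrm{tr}_{d,D}(ab)=\mathrm{tr}_{d,D}(ba)$; $\mathrm{tr}_{d,D}(1)=1$; $\mathrm{tr}_{d,D}(ag_n)=z\,\mathrm{tr}_{d,D}(a)$; $\mathrm{tr}_{d,D}(at_{n+1}^k)=\mathrm{x}_k\,\mathrm{tr}_{d,D}(a)$ for $1\le k\le d-1$. One has $E_D:=\mathrm{tr}_{d,D}(e_i)=1/|D|$. Set $\lambda_D=\frac{z-(q-q^{-1})E_D}{z}$ and $\Lambda_D=\frac{1}{z\sqrt{\lambda_D}}$. For $\alpha\in B_n$ with closure $\widehat\alpha$ and exponent sum $\epsilon(\alpha)$, the isotopy invariant $\Theta_{d,D}=\Theta_{d,D}(q,z)$ of oriented classical links is $\Theta_{d,D}(\widehat\alpha)=\Lambda_D^{n-1}(\sqrt{\lambda_D})^{\epsilon(\alpha)}\,\mathrm{tr}_{d,D}(\alpha)$, where $\mathrm{tr}_{d,D}(\alpha)$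 is the trace of the image of $\alpha$ under $\sigma_i\mapsto g_i$. *)

theory Defs
  imports
    "HOL-Analysis.Analysis"
    "HOL-Library.Poly_Mapping"
    "HOL-Algebra.QuotRing"
    "HOL-Algebra.Algebraic_Closure_Type"
begin

section \<open>Yokonuma--Hecke algebras\<close>

text \<open>
  The free complex algebra on symbols \<open>G i\<close>, \<open>T j\<close> is the monoid algebra of the free monoid.
  The free monoid is written additively, because multiplication on
  \<^typ>\<open>'a \<Rightarrow>\<^sub>0 'b\<close> is convolution with respect to addition of the keys.
\<close>

datatype gen = G nat | T nat

datatype monom_word = Word (letters: "gen list")

instantiation monom_word :: monoid_add
begin

definition zero_monom_word :: monom_word where
  "0 = Word []"

definition plus_monom_word :: "monom_word \<Rightarrow> monom_word \<Rightarrow> monom_word" where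
  "u + v = Word (letters u @ letters v)"

instance
  by standard (auto simp: zero_monom_word_def plus_monom_word_def)

end

type_synonym free_alg = "monom_word \<Rightarrow>\<^sub>0 complex"

definition scalar :: "complex \<Rightarrow> free_alg" where
  "scalar c = Poly_Mapping.single 0 c"

definition gen_g :: "nat \<Rightarrow> free_alg" where
  "gen_g i = Poly_Mapping.single (Word [G i]) 1"

definition gen_t :: "nat \<Rightarrow> free_alg" where
  "gen_t j = Poly_Mapping.single (Word [T j]) 1"

definition free_algebra :: "nat \<Rightarrow> free_alg ring" where
  "free_algebra n =
     \<lparr>carrier = {p. \<forall>w \<in> Poly_Mapping.keys p. set (letters w) \<subseteq> G ` {1..<n} \<union> T ` {1..n}},
      monoid.mult = (*), one = 1, ring.zero = 0, add = (+)\<rparr>"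

definition idem_e :: "nat \<Rightarrow> nat \<Rightarrow> free_alg" where
  "idem_e d i = scalar (1 / of_nat d) * (\<Sum>s<d. gen_t i ^ s * gen_t (i + 1) ^ (d - s))"

definition YH_relators :: "complex \<Rightarrow> nat \<Rightarrow> nat \<Rightarrow> free_alg set" where
  "YH_relators q d n =
     {gen_g i * gen_g j * gen_g i - gen_g j * gen_g i * gen_g j | i j.
        i \<in> {1..<n} \<and> j \<in> {1..<n} \<and> \<bar>int i - int j\<bar> = 1}
   \<union> {gen_g i * gen_g j - gen_g j * gen_g i | i j.
        i \<in> {1..<n} \<and> j \<in> {1..<n} \<and> \<bar>int i - int j\<bar> > 1}
   \<union> {gen_t i * gen_t j - gen_t j * gen_t i | i j. i \<in> {1..n} \<and> j \<in> {1..n}}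
   \<union> {gen_t j * gen_g i - gen_g i * gen_t (Transposition.transpose i (i + 1) j) | i j.
        i \<in> {1..<n} \<and> j \<in> {1..n}}
   \<union> {gen_t j ^ d - 1 | j. j \<in> {1..n}}
   \<union> {gen_g i ^ 2 - (1 + scalar (q - inverse q) * idem_e d i * gen_g i) | i. i \<in> {1..<n}}"

definition YH_ideal :: "complex \<Rightarrow> nat \<Rightarrow> nat \<Rightarrow> free_alg set" where
  "YH_ideal q d n = Idl\<^bsub>free_algebra n\<^esub> (YH_relators q d n)"

definition YH :: "complex \<Rightarrow> nat \<Rightarrow> nat \<Rightarrow> free_alg set ring" where
  "YH q d n = free_algebra n Quot YH_ideal q d n"

definition YH_class :: "complex \<Rightarrow> nat \<Rightarrow> nat \<Rightarrow> free_alg \<Rightarrow> free_alg set" where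
  "YH_class q d n p = YH_ideal q d n +>\<^bsub>free_algebra n\<^esub> p"


section \<open>The specialized trace\<close>

text \<open>Subsets of $\mathbb{Z}/d\mathbb{Z}$ are given by residues in \<open>{0,\<dots>,d-1}\<close>.\<close>

definition residue_subset :: "nat \<Rightarrow> nat set \<Rightarrow> bool" where
  "residue_subset d D \<longleftrightarrow> D \<noteq> {} \<and> D \<subseteq> {..<d}"

definition E_solution :: "nat \<Rightarrow> nat set \<Rightarrow> nat \<Rightarrow> complex" where
  "E_solution d D k =
     1 / of_nat (card D) * (\<Sum>m\<in>D. exp (2 * of_real pi * \<i> * of_nat (k * m) / of_nat d))"

text \<open>
  A linear map on the union of the algebras \<open>YH q d n\<close> is a family of linear maps \<open>\<tau> n\<close>, compatible
  with the natural inclusions. Elements of \<open>YH q d n\<close> are written as classes of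
  representatives in \<open>free_algebra n\<close>, so that the inclusion sends the class of \<open>a\<close> to the
  class of \<open>a\<close> one level up. Since $g_0$ does not exist, the rule for $g_n$ starts at \<open>n = 1\<close>.
  The indeterminate $z$ is the polynomial \<open>[:0, 1:]\<close>.
\<close>

definition is_specialized_trace ::
  "complex \<Rightarrow> nat \<Rightarrow> nat set \<Rightarrow> (nat \<Rightarrow> free_alg set \<Rightarrow> complex poly) \<Rightarrow> bool" where
  "is_specialized_trace q d D \<tau> \<longleftrightarrow>
     (\<forall>n. \<forall>a \<in> carrier (free_algebra n). \<forall>b \<in> carrier (free_algebra n).
        \<tau> n (YH_class q d n (a + b)) = \<tau> n (YH_class q d n a) + \<tau> n (YH_class q d n b)) \<and>
     (\<forall>n c. \<forall>a \<in> carrier (free_algebra n).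
        \<tau> n (YH_class q d n (scalar c * a)) = Polynomial.smult c (\<tau> n (YH_class q d n a))) \<and>
     (\<forall>n. \<forall>a \<in> carrier (free_algebra n).
        \<tau> (n + 1) (YH_class q d (n + 1) a) = \<tau> n (YH_class q d n a)) \<and>
     (\<forall>n. \<forall>a \<in> carrier (free_algebra n). \<forall>b \<in> carrier (free_algebra n).
        \<tau> n (YH_class q d n (a * b)) = \<tau> n (YH_class q d n (b * a))) \<and>
     (\<forall>n. \<tau> n (YH_class q d n 1) = 1) \<and>
     (\<forall>n\<ge>1. \<forall>a \<in> carrier (free_algebra n).
        \<tau> (n + 1) (YH_class q d (n + 1) (a * gen_g n)) = [:0, 1:] * \<tau> n (YH_class q d n a)) \<and>
     (\<forall>n. \<forall>a \<in> carrier (free_algebra n). \<forall>k \<in> {1..<d}.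
        \<tau> (n + 1) (YH_class q d (n + 1) (a * gen_t (n + 1) ^ k)) =
          Polynomial.smult (E_solution d D k) (\<tau> n (YH_class q d n a)))"


section \<open>Braids\<close>

text \<open>The letter \<open>(i, True)\<close> stands for $\sigma_i$ and \<open>(i, False)\<close> for $\sigma_i^{-1}$.\<close>

type_synonym braid_word = "(nat \<times> bool) list"

definition braid_words :: "nat \<Rightarrow> braid_word set" where
  "braid_words n = lists ({1..<n} \<times> UNIV)"

inductive braid_step :: "nat \<Rightarrow> braid_word \<Rightarrow> braid_word \<Rightarrow> bool" for n where
  cancel: "\<lbrakk>u \<in> braid_words n; v \<in> braid_words n; i \<in> {1..<n}\<rbrakk> \<Longrightarrow>
     braid_step n (u @ [(i, s), (i, \<not> s)] @ v) (u @ v)"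
| far: "\<lbrakk>u \<in> braid_words n; v \<in> braid_words n; i \<in> {1..<n}; j \<in> {1..<n};
     \<bar>int i - int j\<bar> > 1\<rbrakk> \<Longrightarrow>
     braid_step n (u @ [(i, True), (j, True)] @ v) (u @ [(j, True), (i, True)] @ v)"
| near: "\<lbrakk>u \<in> braid_words n; v \<in> braid_words n; i \<in> {1..<n}; j \<in> {1..<n};
     \<bar>int i - int j\<bar> = 1\<rbrakk> \<Longrightarrow>
     braid_step n (u @ [(i, True), (j, True), (i, True)] @ v)
                  (u @ [(j, True), (i, True), (j, True)] @ v)"

definition braid_rel :: "nat \<Rightarrow> braid_word rel" where
  "braid_rel n = {(u, v). u \<in> braid_words n \<and> v \<in> braid_words n \<and> equivclp (braid_step n) u v}"

definition braid_group :: "nat \<Rightarrow> braid_word set monoid" where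
  "braid_group n =
     \<lparr>carrier = braid_words n // braid_rel n,
      monoid.mult = (\<lambda>A B. \<Union>a\<in>A. \<Union>b\<in>B. braid_rel n `` {a @ b}),
      one = braid_rel n `` {[]}\<rparr>"

definition exponent_sum :: "braid_word \<Rightarrow> int" where
  "exponent_sum w = (\<Sum>(i, s)\<leftarrow>w. if s then 1 else - 1)"

text \<open>The image of a braid in \<open>YH q d n\<close> under the homomorphism $\sigma_i \mapsto g_i$,
  computed on a representing word.\<close>

fun braid_image :: "complex \<Rightarrow> nat \<Rightarrow> nat \<Rightarrow> braid_word \<Rightarrow> free_alg set" where
  "braid_image q d n [] = \<one>\<^bsub>YH q d n\<^esub>"
| "braid_image q d n ((i, s) # w) =
     (if s then YH_class q d n (gen_g i) else inv\<^bsub>YH q d n\<^esub> YH_class q d n (gen_g i))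
       \<otimes>\<^bsub>YH q d n\<^esub> braid_image q d n w"


section \<open>Oriented links and closures of braids\<close>

text \<open>
  Oriented links in three-space are polygonal: a link is the finite set of its directed edges.
  Every vertex has exactly one incoming and one outgoing edge, and two distinct edges
  meet at most in common end points. Isotopy of polygonal links is generated by
  Reidemeister's triangle moves.
\<close>

type_synonym point = "real \<times> real \<times> real"

definition edges_support :: "point rel \<Rightarrow> point set" where
  "edges_support L = (\<Union>(a, b)\<in>L. closed_segment a b)"

definition oriented_link :: "point rel \<Rightarrow> bool" where
  "oriented_link L \<longleftrightarrow>
     finite L \<and> L \<noteq> {} \<and> irrefl L \<and> single_valued L \<and> single_valued (L\<inverse>) \<and> Domain L = Range L \<and>
     (\<forall>(a, b)\<in>L. \<forall>(a', b')\<in>L. (a, b) \<noteq> (a', b') \<longrightarrow>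
        closed_segment a b \<inter> closed_segment a' b' \<subseteq> {a, b} \<inter> {a', b'})"

definition triangle_move :: "point rel \<Rightarrow> point rel \<Rightarrow> bool" where
  "triangle_move L L' \<longleftrightarrow> oriented_link L \<and> oriented_link L' \<and>
     (\<exists>a b c. (a, b) \<in> L \<and> L' = (L - {(a, b)}) \<union> {(a, c), (c, b)} \<and>
        convex hull {a, b, c} \<inter> edges_support L = closed_segment a b)"

definition isotopic :: "point rel \<Rightarrow> point rel \<Rightarrow> bool" where
  "isotopic = equivclp triangle_move"

text \<open>
  The strands of a braid run upwards, in the direction of the second coordinate, and \<open>w ! j\<close> is
  drawn between heights \<open>j\<close> and \<open>j + 1\<close>. Seen from large third coordinate, $\sigma_i$ is a
  positive crossing: the strand going from position \<open>i\<close> to \<open>i + 1\<close> passes over.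
\<close>

definition crossing_edges :: "nat \<Rightarrow> nat \<Rightarrow> nat \<times> bool \<Rightarrow> point rel" where
  "crossing_edges n j = (\<lambda>(i, s).
     let P = (\<lambda>k l. (real k, real l, 0));
         M = (real i + 1/2, real j + 1/2, 1)
     in {(P k j, P k (j + 1)) | k. k \<in> {1..n} - {i, i + 1}} \<union>
        (if s then {(P i j, M), (M, P (i + 1) (j + 1)), (P (i + 1) j, P i (j + 1))}
         else {(P (i + 1) j, M), (M, P i (j + 1)), (P i j, P (i + 1) (j + 1))}))"

text \<open>The end points at height \<open>m\<close> are joined to those at height \<open>0\<close> by nested planar arcs
  to the right of the braid.\<close>

definition closing_edges :: "nat \<Rightarrow> nat \<Rightarrow> nat \<Rightarrow> point rel" where
  "closing_edges n m k =
     (let x = real k; h = real n + 1 - real k;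
          A = (x, real m, 0);
          B = (x, real m + h, 0);
          C = (real n + h, real m + h, 0);
          C' = (real n + h, - h, 0);
          B' = (x, - h, 0);
          A' = (x, 0, 0)
      in {(A, B), (B, C), (C, C'), (C', B'), (B', A')})"

definition closure_link :: "nat \<Rightarrow> braid_word \<Rightarrow> point rel" where
  "closure_link n w =
     (\<Union>j<length w. crossing_edges n j (w ! j)) \<union> (\<Union>k\<in>{1..n}. closing_edges n (length w) k)"


section \<open>The invariants\<close>

text \<open>
  The values of the invariants involve $\sqrt{\lambda_D}$, so they lie in an algebraic extension of
  $\mathbb{C}(z)$; the algebraic closure is used, and \<open>rt\<close> is a choice of square roots there,
  made once for all \<open>d\<close> and \<open>D\<close>. The argument \<open>tr\<close> is the family of the specialized traces.
\<close>

type_synonym theta_field = "complex poly fract alg_closure"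

definition emb :: "complex poly \<Rightarrow> theta_field" where
  "emb p = to_ac (to_fract p)"

type_synonym trace_family = "nat \<Rightarrow> nat set \<Rightarrow> nat \<Rightarrow> free_alg set \<Rightarrow> complex poly"

definition E_trace :: "complex \<Rightarrow> trace_family \<Rightarrow> nat \<Rightarrow> nat set \<Rightarrow> complex poly" where
  "E_trace q tr d D = tr d D 2 (YH_class q d 2 (idem_e d 1))"

definition lam :: "complex \<Rightarrow> trace_family \<Rightarrow> nat \<Rightarrow> nat set \<Rightarrow> theta_field" where
  "lam q tr d D =
     (emb [:0, 1:] - emb [:q - inverse q:] * emb (E_trace q tr d D)) / emb [:0, 1:]"

definition Lam ::
  "complex \<Rightarrow> (theta_field \<Rightarrow> theta_field) \<Rightarrow> trace_family \<Rightarrow> nat \<Rightarrow> nat set \<Rightarrow> theta_field" where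
  "Lam q rt tr d D = 1 / (emb [:0, 1:] * rt (lam q tr d D))"

definition Theta_braid ::
  "complex \<Rightarrow> (theta_field \<Rightarrow> theta_field) \<Rightarrow> trace_family \<Rightarrow> nat \<Rightarrow> nat set \<Rightarrow> nat \<Rightarrow> braid_word \<Rightarrow> theta_field"
where
  "Theta_braid q rt tr d D n w =
     Lam q rt tr d D ^ (n - 1) * rt (lam q tr d D) powi exponent_sum w *
     emb (tr d D n (braid_image q d n w))"

text \<open>By the theorems of Alexander and Markov, the value below exists and is unique
  for every oriented link.\<close>

definition Theta ::
  "complex \<Rightarrow> (theta_field \<Rightarrow> theta_field) \<Rightarrow> trace_family \<Rightarrow> nat \<Rightarrow> nat set \<Rightarrow> point rel \<Rightarrow> theta_field"
where
  "Theta q rt tr d D = (\<lambda>L\<in>{L. oriented_link L}.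
     THE v. \<exists>n\<ge>1. \<exists>\<alpha>\<in>carrier (braid_group n). \<exists>w\<in>\<alpha>.
       isotopic L (closure_link n w) \<and> v = Theta_braid q rt tr d D n w)"

definition Theta_full ::
  "complex \<Rightarrow> (theta_field \<Rightarrow> theta_field) \<Rightarrow> trace_family \<Rightarrow> nat \<Rightarrow> point rel \<Rightarrow> theta_field"
where
  "Theta_full q rt tr d = Theta q rt tr d {..<d}"

end

theory Submission
  imports Defs
begin

text \<open>
  The trace of a braid is computed by splitting \<open>1\<close> into the joint eigenprojections of the commuting
  elements $t_1,\dots,t_n$ of order $d$. Such a projection is a colouring of the \<open>n\<close> strands by residues
  modulo $d$, and the generator $g_i$ exchanges the colours of two adjacent strands. On a coloured
  element the idempotent $e_i$ is \<open>1\<close> if the strands \<open>i\<close> and \<open>i + 1\<close> have the same colour and \<open>0\<close>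
  otherwise (\<open>idem_e_colour_proj\<close>). Hence the quadratic relation, restricted to a coloured
  element, mentions neither \<open>d\<close> nor the colours themselves, but only the pattern of equalities among
  the colours.

  Consequently a coloured braid on \<open>n + 1\<close> strands can be rewritten as a combination of products of a
  braid on \<open>n\<close> strands, a coset representative $g_n\cdots g_k$ and the colouring, with coefficients that
  depend on the pattern only (\<open>reducible_braid\<close>). On the colours, the solution of the E-system
  parametrized by \<open>D\<close> is the uniform distribution on \<open>D\<close>: removing the last strand when it is
  untouched multiplies the trace by $1/|D|$ if its colour lies in \<open>D\<close>, and gives \<open>0\<close> otherwise
  (\<open>trace_eigenproj\<close>). When the last strand is involved, removing it multiplies the trace by $z$ or by
  \<open>0\<close>, and the pattern decides which (\<open>trace_coloured_descent\<close>). By induction on the number of strands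
  the trace of a coloured braid vanishes if a colour lies outside \<open>D\<close>, and otherwise depends on \<open>D\<close> only
  through $|D|$ (\<open>braid_determined\<close>).

  Summing over all colourings with values in \<open>D\<close>, any bijection between two sets \<open>D\<close> and \<open>D'\<close>, possibly
  of residues for different moduli, identifies the traces of every braid. The same argument gives
  the trace of $e_1$, and therefore all ingredients of the invariants. In particular every invariant
  equals the one for the full set of residues modulo $|D|$.
\<close>

section \<open>The presented algebras\<close>

lemma poly_mapping_additive_induct [case_names zero add single]:
  fixes p :: "'a \<Rightarrow>\<^sub>0 'b::comm_monoid_add"
  assumes "P 0" "\<And>p p'. P p \<Longrightarrow> P p' \<Longrightarrow> P (p + p')" "\<And>k c. P (Poly_Mapping.single k c)"
  shows "P p"
proof (induction p rule: update_induct)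
  case const
  show ?case by (fact assms(1))
next
  case (update f a b)
  have "Poly_Mapping.update a b f = f + Poly_Mapping.single a b"
    using update(1) by (intro poly_mapping_eqI)
      (auto simp: lookup_add lookup_update lookup_single when_def in_keys_iff)
  then show ?case using update assms by simp
qed

lemma scalar_simps [simp]:
  "scalar 0 = 0" "scalar 1 = 1" "scalar (a + b) = scalar a + scalar b"
  "scalar (a - b) = scalar a - scalar b" "scalar (a * b) = scalar a * scalar b"
  by (simp_all add: scalar_def single_add single_diff mult_single)

lemma scalar_sum: "scalar (sum f I) = (\<Sum>i\<in>I. scalar (f i))"
  by (induction I rule: infinite_finite_induct) simp_all

lemma scalar_commute: "scalar c * p = p * scalar c"
proof (induction p rule: poly_mapping_additive_induct)
  case (single k a)
  then show ?case by (simp add: scalar_def mult_single ac_simps)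
qed (simp_all add: algebra_simps)

lemma scalar_left_commute: "p * (scalar c * r) = scalar c * (p * r)"
  by (metis mult.assoc scalar_commute)

text \<open>
  The free algebra of level \<open>n\<close>. Levels are kept apart because the trace rules for \<open>gen_g n\<close> and
  \<open>gen_t (n + 1)\<close> apply only to elements of level \<open>n\<close>.
\<close>

abbreviation A :: "nat \<Rightarrow> free_alg set" where "A n \<equiv> carrier (free_algebra n)"

lemma A_iff: "p \<in> A n \<longleftrightarrow>
    (\<forall>w\<in>Poly_Mapping.keys p. set (letters w) \<subseteq> G ` {1..<n} \<union> T ` {1..n})"
  by (simp add: free_algebra_def)

lemma A_mono: "m \<le> n \<Longrightarrow> p \<in> A m \<Longrightarrow> p \<in> A n"
proof -
  assume "m \<le> n" "p \<in> A m"
  moreover have "G ` {1..<m} \<union> T ` {1..m} \<subseteq> G ` {1..<n} \<union> T ` {1..n}" if "m \<le> n"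
    using that by (intro Un_mono image_mono) auto
  ultimately show "p \<in> A n" unfolding A_iff by (meson subset_trans)
qed

lemma scalar_A [simp]: "scalar c \<in> A n"
  unfolding A_iff scalar_def by (simp add: zero_monom_word_def)

lemma A_0 [simp]: "0 \<in> A n" and A_1 [simp]: "1 \<in> A n"
  using scalar_A[of 0] scalar_A[of 1] by simp_all

lemma A_add [simp]: "p \<in> A n \<Longrightarrow> r \<in> A n \<Longrightarrow> p + r \<in> A n"
  using keys_add[of p r] unfolding A_iff by blast

lemma A_minus [simp]: "p \<in> A n \<Longrightarrow> - p \<in> A n"
  unfolding A_iff by simp

lemma A_diff [simp]: "p \<in> A n \<Longrightarrow> r \<in> A n \<Longrightarrow> p - r \<in> A n"
  using A_add[of p n "- r"] by simp

lemma A_mult [simp]: "p \<in> A n \<Longrightarrow> r \<in> A n \<Longrightarrow> p * r \<in> A n"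
proof -
  assume "p \<in> A n" "r \<in> A n"
  then have "set (letters (u + v)) \<subseteq> G ` {1..<n} \<union> T ` {1..n}"
    if "u \<in> Poly_Mapping.keys p" "v \<in> Poly_Mapping.keys r" for u v
    using that unfolding A_iff plus_monom_word_def by simp
  then show "p * r \<in> A n"
    using keys_mult[of p r] unfolding A_iff by blast
qed

lemma A_power [simp]: "p \<in> A n \<Longrightarrow> p ^ k \<in> A n"
  by (induction k) simp_all

lemma A_sum: "(\<And>i. i \<in> I \<Longrightarrow> f i \<in> A n) \<Longrightarrow> sum f I \<in> A n"
  by (induction I rule: infinite_finite_induct) simp_all

lemma gen_g_A [simp]: "gen_g i \<in> A n \<longleftrightarrow> i \<in> {1..<n}"
  by (auto simp: A_iff gen_g_def)

lemma gen_t_A [simp]: "gen_t i \<in> A n \<longleftrightarrow> i \<in> {1..n}"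
  by (auto simp: A_iff gen_t_def)

lemma idem_e_A [simp]: "i \<in> {1..<n} \<Longrightarrow> idem_e d i \<in> A n"
  unfolding idem_e_def by (auto intro!: A_mult A_sum A_power)


lemma free_algebra_sel [simp]:
  "mult (free_algebra n) = (*)" "one (free_algebra n) = 1"
  "ring.zero (free_algebra n) = 0" "add (free_algebra n) = (+)"
  by (simp_all add: free_algebra_def)

lemma ring_free_algebra: "ring (free_algebra n)"
proof (rule ringI)
  show "abelian_group (free_algebra n)"
  proof (rule abelian_groupI)
    fix x assume "x \<in> A n"
    then show "\<exists>y\<in>A n. y \<oplus>\<^bsub>free_algebra n\<^esub> x = \<zero>\<^bsub>free_algebra n\<^esub>"
      by (intro bexI[of _ "- x"]) simp_all
  qed (simp_all add: add_ac)
  show "monoid (free_algebra n)"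
    by (rule monoidI) (simp_all add: mult.assoc)
qed (simp_all add: distrib_left distrib_right)

lemma YH_relators_subset: "YH_relators q d n \<subseteq> A n"
proof -
  have "Transposition.transpose i (i + 1) j \<in> {1..n}" if "i \<in> {1..<n}" "j \<in> {1..n}" for i j
    using that by (auto simp: Transposition.transpose_def)
  then show ?thesis
    unfolding YH_relators_def by auto
qed

lemma ideal_YH_ideal: "ideal (YH_ideal q d n) (free_algebra n)"
  unfolding YH_ideal_def
  by (rule ring.genideal_ideal[OF ring_free_algebra YH_relators_subset])

lemma YH_relator_in_ideal: "r \<in> YH_relators q d n \<Longrightarrow> r \<in> YH_ideal q d n"
  unfolding YH_ideal_def
  using ring.genideal_self[OF ring_free_algebra YH_relators_subset] by blast

lemma YH_ideal_subset: "p \<in> YH_ideal q d n \<Longrightarrow> p \<in> A n"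
  using ideal.Icarr[OF ideal_YH_ideal] .

lemma YH_ideal_zero [simp]: "0 \<in> YH_ideal q d n"
  using additive_subgroup.zero_closed[OF ideal.axioms(1)[OF ideal_YH_ideal]] by simp

lemma YH_ideal_add: "p \<in> YH_ideal q d n \<Longrightarrow> r \<in> YH_ideal q d n \<Longrightarrow> p + r \<in> YH_ideal q d n"
  using additive_subgroup.a_closed[OF ideal.axioms(1)[OF ideal_YH_ideal]] by simp

lemma YH_ideal_mult:
  assumes "p \<in> YH_ideal q d n" "u \<in> A n" "v \<in> A n"
  shows "u * p * v \<in> YH_ideal q d n"
  using ideal.I_l_closed[OF ideal_YH_ideal] ideal.I_r_closed[OF ideal_YH_ideal] assms by simp

lemma YH_ideal_lmult: "p \<in> YH_ideal q d n \<Longrightarrow> u \<in> A n \<Longrightarrow> u * p \<in> YH_ideal q d n"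
  using YH_ideal_mult[of p q d n u 1] by simp

lemma YH_ideal_rmult: "p \<in> YH_ideal q d n \<Longrightarrow> u \<in> A n \<Longrightarrow> p * u \<in> YH_ideal q d n"
  using YH_ideal_mult[of p q d n 1 u] by simp

lemma YH_ideal_minus: "p \<in> YH_ideal q d n \<Longrightarrow> - p \<in> YH_ideal q d n"
  using YH_ideal_mult[of p q d n "- 1" 1] by simp

lemma YH_ideal_diff: "p \<in> YH_ideal q d n \<Longrightarrow> r \<in> YH_ideal q d n \<Longrightarrow> p - r \<in> YH_ideal q d n"
  using YH_ideal_add[of p q d n "- r"] YH_ideal_minus by simp

lemma YH_ideal_sum: "(\<And>i. i \<in> I \<Longrightarrow> f i \<in> YH_ideal q d n) \<Longrightarrow> sum f I \<in> YH_ideal q d n"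
  by (induction I rule: infinite_finite_induct) (simp_all add: YH_ideal_add)

lemma YH_relators_mono: "m \<le> n \<Longrightarrow> YH_relators q d m \<subseteq> YH_relators q d n"
proof -
  assume "m \<le> n"
  then have "{1..<m} \<subseteq> {1..<n}" "{1..m} \<subseteq> {1..n}" by auto
  then show ?thesis unfolding YH_relators_def by (intro Un_mono) blast+
qed

text \<open>The inclusion of the free algebras is compatible with the relations, because the part of the
  larger ideal that lies in the smaller free algebra is an ideal there.\<close>

lemma YH_ideal_mono:
  assumes "m \<le> n"
  shows "YH_ideal q d m \<subseteq> YH_ideal q d n"
proof -
  have "ideal (YH_ideal q d n \<inter> A m) (free_algebra m)"
  proof (rule idealI[OF ring_free_algebra])
    show "subgroup (YH_ideal q d n \<inter> A m) (add_monoid (free_algebra m))"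
    proof (rule subgroup.intro)
      fix x assume x: "x \<in> YH_ideal q d n \<inter> A m"
      have "inv\<^bsub>add_monoid (free_algebra m)\<^esub> x = - x"
        using x ring.is_abelian_group[OF ring_free_algebra, of m]
        by (intro monoid.inv_char)
          (auto simp: abelian_group_def abelian_group_axioms_def comm_group_def group_def)
      then show "inv\<^bsub>add_monoid (free_algebra m)\<^esub> x \<in> YH_ideal q d n \<inter> A m"
        using x YH_ideal_minus by simp
    qed (auto intro: YH_ideal_add)
  qed (use assms in \<open>auto intro: YH_ideal_lmult YH_ideal_rmult A_mono\<close>)
  moreover have "YH_relators q d m \<subseteq> YH_ideal q d n \<inter> A m"
    using YH_relators_mono[OF assms] YH_relators_subset YH_relator_in_ideal by blast
  ultimately show ?thesis
    unfolding YH_ideal_def[of q d m]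
    using ring.genideal_minimal[OF ring_free_algebra] by blast
qed

lemma a_minus_free_algebra: "r \<in> A n \<Longrightarrow> p \<ominus>\<^bsub>free_algebra n\<^esub> r = p - r"
proof -
  assume r: "r \<in> A n"
  have "\<ominus>\<^bsub>free_algebra n\<^esub> r = - r"
    using r ring.is_abelian_group[OF ring_free_algebra, of n]
    unfolding a_inv_def by (intro monoid.inv_char)
      (auto simp: abelian_group_def abelian_group_axioms_def comm_group_def group_def)
  then show ?thesis by (simp add: a_minus_def)
qed

lemma YH_class_eq:
  assumes "a \<in> A n" "b \<in> A n" "a - b \<in> YH_ideal q d n"
  shows "YH_class q d n a = YH_class q d n b"
proof -
  have ag: "abelian_subgroup (YH_ideal q d n) (free_algebra n)"
    using abelian_subgroupI3[OF ideal.axioms(1)[OF ideal_YH_ideal]]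
      ring.is_abelian_group[OF ring_free_algebra] by blast
  have "a \<in> YH_class q d n b"
    using abelian_subgroup.a_rcos_module_minus[OF ag ring_free_algebra assms(2,1)] assms
    by (simp add: YH_class_def a_minus_free_algebra)
  then show ?thesis
    using abelian_subgroup.a_repr_independence'[OF ag] assms(2) unfolding YH_class_def by metis
qed

lemma YH_class_hom: "YH_class q d n \<in> ring_hom (free_algebra n) (YH q d n)"
  using ideal.rcos_ring_hom[OF ideal_YH_ideal] unfolding YH_class_def YH_def .

lemma YH_class_mult:
  "a \<in> A n \<Longrightarrow> b \<in> A n \<Longrightarrow> YH_class q d n a \<otimes>\<^bsub>YH q d n\<^esub> YH_class q d n b = YH_class q d n (a * b)"
  using ring_hom_mult[OF YH_class_hom] by simp

lemma YH_class_one: "\<one>\<^bsub>YH q d n\<^esub> = YH_class q d n 1"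
  using ring_hom_one[OF YH_class_hom] by simp

lemma YH_class_closed: "a \<in> A n \<Longrightarrow> YH_class q d n a \<in> carrier (YH q d n)"
  using ring_hom_closed[OF YH_class_hom] .

lemma ring_YH: "ring (YH q d n)"
  unfolding YH_def by (rule ideal.quotient_is_ring[OF ideal_YH_ideal])


subsection \<open>The inverse of a braiding generator\<close>

text \<open>
  Inverting \<open>gen_g i\<close> requires that it commutes with \<open>idem_e d i\<close>: the quadratic relation alone gives
  only a left inverse. Conjugation by \<open>gen_g i\<close> exchanges \<open>gen_t i\<close> and \<open>gen_t (i + 1)\<close>, under which the
  idempotent is symmetric.
\<close>

lemma t_power_g:
  assumes "i \<in> {1..<n}" "j \<in> {1..n}"
  shows "gen_t j ^ s * gen_g i - gen_g i * gen_t (Transposition.transpose i (i + 1) j) ^ s \<in> YH_ideal q d n"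
    (is "_ - _ * ?t' ^ s \<in> _")
proof (induction s)
  case (Suc s)
  have A: "?t' \<in> A n"
    using assms by (auto simp: Transposition.transpose_def)
  have r: "gen_t j * gen_g i - gen_g i * ?t' \<in> YH_ideal q d n"
    using assms by (intro YH_relator_in_ideal) (unfold YH_relators_def, blast)
  have "gen_t j ^ Suc s * gen_g i - gen_g i * ?t' ^ Suc s =
      gen_t j * (gen_t j ^ s * gen_g i - gen_g i * ?t' ^ s)
      + (gen_t j * gen_g i - gen_g i * ?t') * ?t' ^ s"
    by (simp add: algebra_simps)
  also have "\<dots> \<in> YH_ideal q d n"
    using assms A by (intro YH_ideal_add YH_ideal_lmult YH_ideal_rmult Suc r) auto
  finally show ?case .
qed simp

lemma t_power_commute:
  assumes "i \<in> {1..n}" "j \<in> {1..n}"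
  shows "gen_t i ^ s * gen_t j ^ r - gen_t j ^ r * gen_t i ^ s \<in> YH_ideal q d n"
proof -
  have 0: "gen_t i * gen_t j - gen_t j * gen_t i \<in> YH_ideal q d n"
    using assms by (intro YH_relator_in_ideal) (unfold YH_relators_def, blast)
  have 1: "gen_t i * gen_t j ^ r - gen_t j ^ r * gen_t i \<in> YH_ideal q d n" for r
  proof (induction r)
    case (Suc r)
    have "gen_t i * gen_t j ^ Suc r - gen_t j ^ Suc r * gen_t i =
        (gen_t i * gen_t j - gen_t j * gen_t i) * gen_t j ^ r
        + gen_t j * (gen_t i * gen_t j ^ r - gen_t j ^ r * gen_t i)"
      by (simp add: algebra_simps)
    also have "\<dots> \<in> YH_ideal q d n"
      using assms by (intro YH_ideal_add YH_ideal_lmult YH_ideal_rmult Suc 0) auto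
    finally show ?case .
  qed simp
  show ?thesis
  proof (induction s)
    case (Suc s)
    have "gen_t i ^ Suc s * gen_t j ^ r - gen_t j ^ r * gen_t i ^ Suc s =
        gen_t i * (gen_t i ^ s * gen_t j ^ r - gen_t j ^ r * gen_t i ^ s)
        + (gen_t i * gen_t j ^ r - gen_t j ^ r * gen_t i) * gen_t i ^ s"
      by (simp add: algebra_simps)
    also have "\<dots> \<in> YH_ideal q d n"
      using assms by (intro YH_ideal_add YH_ideal_lmult YH_ideal_rmult Suc 1) auto
    finally show ?case .
  qed simp
qed

lemma e_g_commute:
  assumes "i \<in> {1..<n}"
  shows "idem_e d i * gen_g i - gen_g i * idem_e d i \<in> YH_ideal q d n"
proof -
  define x y g where "x = gen_t i" and "y = gen_t (i + 1)" and "g = gen_g i"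
  have A: "x \<in> A n" "y \<in> A n" "g \<in> A n"
    using assms by (auto simp: x_def y_def g_def)
  have xg: "x ^ s * g - g * y ^ s \<in> YH_ideal q d n" for s
    using t_power_g[of i n i] assms unfolding x_def y_def g_def by simp
  have yg: "y ^ s * g - g * x ^ s \<in> YH_ideal q d n" for s
    using t_power_g[of i n "i + 1"] assms unfolding x_def y_def g_def by simp
  have xd: "x ^ d - y ^ d \<in> YH_ideal q d n"
  proof -
    have "gen_t j ^ d - 1 \<in> YH_ideal q d n" if "j \<in> {1..n}" for j
      using that by (intro YH_relator_in_ideal) (unfold YH_relators_def, blast)
    from YH_ideal_diff[OF this[of i] this[of "i + 1"]]
    have "(x ^ d - 1) - (y ^ d - 1) \<in> YH_ideal q d n"
      unfolding x_def y_def using assms by simp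
    then show ?thesis by simp
  qed
  have swap: "x ^ s * y ^ r * g - g * x ^ r * y ^ s \<in> YH_ideal q d n" for s r
  proof -
    have "x ^ s * y ^ r * g - g * x ^ r * y ^ s =
        x ^ s * (y ^ r * g - g * x ^ r) + (x ^ s * g - g * y ^ s) * x ^ r
        + g * (y ^ s * x ^ r - x ^ r * y ^ s)"
      by (simp add: algebra_simps)
    also have "\<dots> \<in> YH_ideal q d n"
      using A assms by (intro YH_ideal_add YH_ideal_lmult YH_ideal_rmult xg yg A_power)
        (auto simp: x_def y_def intro: t_power_commute)
    finally show ?thesis .
  qed
  \<comment> \<open>Conjugation by \<open>g\<close> reverses the sum defining the idempotent; this exchanges
    the terms with \<open>s = 0\<close> and \<open>s = d\<close>, which agree by \<open>xd\<close>.\<close>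
  have rev: "(\<Sum>s<d. x ^ (d - s) * y ^ s) = (\<Sum>s<d. x ^ s * y ^ (d - s)) + (x ^ d - y ^ d)"
  proof -
    have "(\<Sum>s<Suc d. x ^ (d - s) * y ^ s) = (\<Sum>s<Suc d. x ^ s * y ^ (d - s))"
      by (rule sum.reindex_bij_witness[of _ "\<lambda>s. d - s" "\<lambda>s. d - s"]) auto
    then show ?thesis by (simp add: algebra_simps)
  qed
  have "idem_e d i * g - g * idem_e d i = scalar (1 / of_nat d) *
      ((\<Sum>s<d. x ^ s * y ^ (d - s)) * g - g * (\<Sum>s<d. x ^ s * y ^ (d - s)))"
    unfolding idem_e_def x_def y_def by (simp add: scalar_left_commute algebra_simps)
  also have "\<dots> = scalar (1 / of_nat d) *
      ((\<Sum>s<d. x ^ s * y ^ (d - s) * g - g * x ^ (d - s) * y ^ s) + g * (x ^ d - y ^ d))"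
  proof -
    have "(\<Sum>s<d. x ^ s * y ^ (d - s) * g - g * x ^ (d - s) * y ^ s) =
        (\<Sum>s<d. x ^ s * y ^ (d - s)) * g - g * (\<Sum>s<d. x ^ (d - s) * y ^ s)"
      by (simp add: sum_subtractf sum_distrib_right sum_distrib_left mult.assoc)
    then have "(\<Sum>s<d. x ^ s * y ^ (d - s)) * g - g * (\<Sum>s<d. x ^ s * y ^ (d - s)) =
        (\<Sum>s<d. x ^ s * y ^ (d - s) * g - g * x ^ (d - s) * y ^ s) + g * (x ^ d - y ^ d)"
      by (simp add: rev distrib_left)
    then show ?thesis by (simp only:)
  qed
  also have "\<dots> \<in> YH_ideal q d n"
    using A by (intro YH_ideal_lmult YH_ideal_add YH_ideal_sum swap xd) auto
  finally show ?thesis unfolding g_def .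
qed

definition g_inverse :: "complex \<Rightarrow> nat \<Rightarrow> nat \<Rightarrow> free_alg" where
  "g_inverse q d i = gen_g i - scalar (q - inverse q) * idem_e d i"

lemma inv_YH_class_gen_g:
  assumes "i \<in> {1..<n}"
  shows "inv\<^bsub>YH q d n\<^esub> YH_class q d n (gen_g i) = YH_class q d n (g_inverse q d i)"
proof -
  have r: "gen_g i ^ 2 - (1 + scalar (q - inverse q) * idem_e d i * gen_g i) \<in> YH_ideal q d n"
    using assms by (intro YH_relator_in_ideal) (unfold YH_relators_def, blast)
  have l: "g_inverse q d i * gen_g i - 1 \<in> YH_ideal q d n"
    using r by (simp add: g_inverse_def algebra_simps power2_eq_square)
  have "gen_g i * g_inverse q d i - 1 = (g_inverse q d i * gen_g i - 1) +
      scalar (q - inverse q) * (idem_e d i * gen_g i - gen_g i * idem_e d i)"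
    unfolding g_inverse_def
    by (simp add: algebra_simps scalar_left_commute del: scalar_simps)
  also have "\<dots> \<in> YH_ideal q d n"
    by (intro YH_ideal_add l YH_ideal_lmult e_g_commute assms scalar_A)
  finally have r': "gen_g i * g_inverse q d i - 1 \<in> YH_ideal q d n" .
  have A: "g_inverse q d i \<in> A n" "gen_g i \<in> A n"
    using assms unfolding g_inverse_def by (auto simp del: scalar_simps)
  have "YH_class q d n (g_inverse q d i * gen_g i) = YH_class q d n 1"
    "YH_class q d n (gen_g i * g_inverse q d i) = YH_class q d n 1"
    by (intro YH_class_eq A_mult A A_1 l r')+
  with A show ?thesis
    by (intro monoid.inv_char[OF ring.is_monoid[OF ring_YH]])
      (simp_all add: YH_class_mult YH_class_one YH_class_closed)
qed

section \<open>Congruence modulo the relations of all levels\<close>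

text \<open>
  It is convenient to compute in one algebra with a trace, without fixing a level. The obstacle is that
  the free algebra also contains letters with index zero, which occur in no level. The projection
  \<open>proper\<close> sets them to zero; it is multiplicative, its values lie in some level, and it is the identity
  on every level, so that congruences and traces can be transported along it to all of \<open>free_alg\<close>.
\<close>

definition proper_word :: "monom_word \<Rightarrow> bool" where
  "proper_word w \<longleftrightarrow> G 0 \<notin> set (letters w) \<and> T 0 \<notin> set (letters w)"

lift_definition proper :: "free_alg \<Rightarrow> free_alg" is
  "\<lambda>p w. if proper_word w then p w else 0"
  by (auto elim: rev_finite_subset)

lemma lookup_proper: "Poly_Mapping.lookup (proper p) w = (if proper_word w then Poly_Mapping.lookup p w else 0)"
  by (simp add: proper.rep_eq)

lemma proper_single: "proper (Poly_Mapping.single w c) = (if proper_word w then Poly_Mapping.single w c else 0)"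
  by (rule poly_mapping_eqI) (auto simp: lookup_proper lookup_single when_def)

lemma proper_0 [simp]: "proper 0 = 0"
  by (rule poly_mapping_eqI) (simp add: lookup_proper)

lemma proper_add: "proper (p + r) = proper p + proper r"
  by (rule poly_mapping_eqI) (simp add: lookup_proper lookup_add)

lemma proper_diff: "proper (p - r) = proper p - proper r"
  by (rule poly_mapping_eqI) (simp add: lookup_proper lookup_minus)

lemma proper_mult: "proper (p * r) = proper p * proper r"
proof (induction p rule: poly_mapping_additive_induct)
  case (single u a)
  show ?case
  proof (induction r rule: poly_mapping_additive_induct)
    case (single v b)
    show ?case
      by (auto simp: mult_single proper_single proper_word_def plus_monom_word_def)
  qed (simp_all add: proper_add distrib_left)
qed (simp_all add: proper_add distrib_right)

lemma proper_on_A [simp]: "p \<in> A n \<Longrightarrow> proper p = p"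
  by (rule poly_mapping_eqI) (fastforce simp: lookup_proper proper_word_def A_iff in_keys_iff)

lemma proper_in_A: "\<exists>n. proper p \<in> A n"
proof -
  define index where "index = (\<lambda>x. case x of G i \<Rightarrow> i | T i \<Rightarrow> i)"
  define S where "S = (\<Union>w\<in>Poly_Mapping.keys (proper p). set (letters w))"
  define N where "N = Suc (Max (insert 0 (index ` S)))"
  have "finite S" unfolding S_def by simp
  then have le: "index x < N" if "x \<in> S" for x
    using that unfolding N_def by (auto simp: less_Suc_eq_le)
  have "x \<in> G ` {1..<N} \<union> T ` {1..N}" if "x \<in> S" for x
  proof -
    have "index x \<noteq> 0"
      using that by (auto simp: S_def in_keys_iff lookup_proper proper_word_def index_def
          split: if_splits gen.splits intro!: gr0I)
    then show ?thesis
      using le[OF that] by (cases x) (auto simp: index_def)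
  qed
  then have "proper p \<in> A N"
    unfolding A_iff S_def by blast
  then show ?thesis ..
qed

text \<open>
  Equality in the union of the algebras of all levels.
\<close>

definition YH_cong :: "complex \<Rightarrow> nat \<Rightarrow> free_alg \<Rightarrow> free_alg \<Rightarrow> bool" where
  "YH_cong q d a b \<longleftrightarrow> (\<exists>n. proper (a - b) \<in> YH_ideal q d n)"

lemma YH_congI: "a - b \<in> YH_ideal q d n \<Longrightarrow> YH_cong q d a b"
  unfolding YH_cong_def using YH_ideal_subset proper_on_A by metis

lemma YH_cong_refl [simp]: "YH_cong q d a a"
  unfolding YH_cong_def by simp

lemma YH_cong_add:
  assumes "YH_cong q d a b" "YH_cong q d a' b'"
  shows "YH_cong q d (a + a') (b + b')"
proof -
  obtain n n' where "proper (a - b) \<in> YH_ideal q d n" "proper (a' - b') \<in> YH_ideal q d n'"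
    using assms unfolding YH_cong_def by blast
  then have "proper (a - b) + proper (a' - b') \<in> YH_ideal q d (max n n')"
    by (intro YH_ideal_add) (auto intro: subsetD[OF YH_ideal_mono, rotated])
  then show ?thesis
    unfolding YH_cong_def by (auto simp: proper_add proper_diff algebra_simps)
qed

lemma YH_cong_mult:
  assumes "YH_cong q d a b"
  shows "YH_cong q d (u * a * v) (u * b * v)"
proof -
  obtain n where n: "proper (a - b) \<in> YH_ideal q d n"
    using assms unfolding YH_cong_def by blast
  obtain k l where kl: "proper u \<in> A k" "proper v \<in> A l"
    using proper_in_A by blast
  define N where "N = max n (max k l)"
  have "proper u * proper (a - b) * proper v \<in> YH_ideal q d N"
    using kl n YH_ideal_mono[of n N q d] A_mono[of k N "proper u"] A_mono[of l N "proper v"]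
    by (intro YH_ideal_mult) (auto simp: N_def)
  then show ?thesis
    unfolding YH_cong_def by (auto simp: proper_mult proper_diff algebra_simps)
qed

lemma YH_cong_lmult: "YH_cong q d a b \<Longrightarrow> YH_cong q d (u * a) (u * b)"
  using YH_cong_mult[of q d a b u 1] by simp

lemma YH_cong_rmult: "YH_cong q d a b \<Longrightarrow> YH_cong q d (a * v) (b * v)"
  using YH_cong_mult[of q d a b 1 v] by simp

lemma YH_cong_sym: "YH_cong q d a b \<Longrightarrow> YH_cong q d b a"
  using YH_cong_add[OF YH_cong_refl[of q d "a + b"] YH_cong_lmult[of q d a b "- 1"]] by simp

lemma YH_cong_trans [trans]:
  assumes "YH_cong q d a b" "YH_cong q d b c"
  shows "YH_cong q d a c"
  using YH_cong_add[OF YH_cong_add[OF assms] YH_cong_refl[of q d "- b"]] by simp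

lemma YH_cong_diff:
  assumes "YH_cong q d a b" "YH_cong q d a' b'"
  shows "YH_cong q d (a - a') (b - b')"
  using YH_cong_add[OF assms(1) YH_cong_lmult[OF assms(2), of "- 1"]] by simp

lemma YH_cong_sum:
  "(\<And>i. i \<in> I \<Longrightarrow> YH_cong q d (f i) (h i)) \<Longrightarrow> YH_cong q d (sum f I) (sum h I)"
  by (induction I rule: infinite_finite_induct) (simp_all add: YH_cong_add)

text \<open>
  Moving \<open>x\<close> to the front through a product, a power or a sum, factor by factor. All commutation rules
  for eigenprojections and colourings arise in this way from those for the generators \<open>gen_t j\<close>.
\<close>

lemma YH_cong_swap:
  assumes "YH_cong q d (a * x) (x * b)" "YH_cong q d (a' * x) (x * b')"
  shows "YH_cong q d (a * a' * x) (x * (b * b'))"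
proof -
  have "YH_cong q d (a * (a' * x)) (a * (x * b'))"
    by (intro YH_cong_lmult assms)
  also have "YH_cong q d (a * (x * b')) (x * b * b')"
    unfolding mult.assoc[symmetric] by (intro YH_cong_rmult assms)
  finally show ?thesis by (simp add: mult.assoc)
qed

lemma YH_cong_swap_power: "YH_cong q d (a * x) (x * b) \<Longrightarrow> YH_cong q d (a ^ s * x) (x * b ^ s)"
  by (induction s) (simp_all add: YH_cong_swap)

lemma YH_cong_commute_sum:
  assumes "\<And>i. i \<in> I \<Longrightarrow> YH_cong q d (f i * x) (x * h i)"
  shows "YH_cong q d (sum f I * x) (x * sum h I)"
  unfolding sum_distrib_left sum_distrib_right by (intro YH_cong_sum assms)

lemma YH_cong_swap_scalar:
  assumes "YH_cong q d (a * x) (x * b)"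
  shows "YH_cong q d (scalar c * a * x) (x * (scalar c * b))"
  using YH_cong_lmult[OF assms, of "scalar c"] by (simp add: mult.assoc scalar_left_commute)

subsection \<open>The defining relations as congruences\<close>

lemma cong_braid:
  assumes "i \<ge> 1" "j \<ge> 1" "\<bar>int i - int j\<bar> = 1"
  shows "YH_cong q d (gen_g i * gen_g j * gen_g i) (gen_g j * gen_g i * gen_g j)"
proof (rule YH_congI[OF YH_relator_in_ideal])
  have "i \<in> {1..<i+j+1}" "j \<in> {1..<i+j+1}" using assms by auto
  then show "gen_g i * gen_g j * gen_g i - gen_g j * gen_g i * gen_g j \<in> YH_relators q d (i + j + 1)"
    using assms unfolding YH_relators_def by blast
qed

lemma cong_far:
  assumes "i \<ge> 1" "j \<ge> 1" "\<bar>int i - int j\<bar> > 1"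
  shows "YH_cong q d (gen_g i * gen_g j) (gen_g j * gen_g i)"
proof (rule YH_congI[OF YH_relator_in_ideal])
  have "i \<in> {1..<i+j+1}" "j \<in> {1..<i+j+1}" using assms by auto
  then show "gen_g i * gen_g j - gen_g j * gen_g i \<in> YH_relators q d (i + j + 1)"
    using assms unfolding YH_relators_def by blast
qed

lemma cong_t_power:
  assumes "j \<ge> 1"
  shows "YH_cong q d (gen_t j ^ d) 1"
proof (rule YH_congI[OF YH_relator_in_ideal])
  have "j \<in> {1..j}" using assms by auto
  then show "gen_t j ^ d - 1 \<in> YH_relators q d j"
    unfolding YH_relators_def by blast
qed

lemma cong_t_commute:
  assumes "i \<ge> 1" "j \<ge> 1"
  shows "YH_cong q d (gen_t i * gen_t j) (gen_t j * gen_t i)"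
  using assms t_power_commute[of i "i + j" j 1 1] by (intro YH_congI[of _ _ _ _ "i + j"]) simp

lemma cong_t_g:
  assumes "i \<ge> 1" "j \<ge> 1"
  shows "YH_cong q d (gen_t j * gen_g i) (gen_g i * gen_t (Transposition.transpose i (i + 1) j))"
  using assms t_power_g[of i "i + j" j 1] by (intro YH_congI[of _ _ _ _ "i + j"]) simp

lemma cong_e_g:
  assumes "i \<ge> 1"
  shows "YH_cong q d (idem_e d i * gen_g i) (gen_g i * idem_e d i)"
  using assms e_g_commute[of i "i + 1"] by (intro YH_congI[of _ _ _ _ "i + 1"]) simp

lemma cong_g_square:
  assumes "i \<ge> 1"
  shows "YH_cong q d (gen_g i * gen_g i) (1 + scalar (q - inverse q) * idem_e d i * gen_g i)"
proof (rule YH_congI[OF YH_relator_in_ideal])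
  have "i \<in> {1..<i+1}" using assms by auto
  then have "gen_g i ^ 2 - (1 + scalar (q - inverse q) * idem_e d i * gen_g i) \<in> YH_relators q d (i + 1)"
    unfolding YH_relators_def by blast
  then show "gen_g i * gen_g i - (1 + scalar (q - inverse q) * idem_e d i * gen_g i) \<in> YH_relators q d (i + 1)"
    by (simp only: power2_eq_square)
qed

section \<open>Colourings and joint eigenprojections\<close>

text \<open>
  The generators \<open>gen_t j\<close> commute and satisfy \<open>gen_t j ^ d = 1\<close>, so they are simultaneously
  diagonalisable. A colouring assigns to each strand \<open>j\<close> an exponent \<open>m < d\<close>, which stands for the
  eigenvalue \<open>zeta d ^ m\<close> of \<open>gen_t j\<close>.
\<close>

definition zeta :: "nat \<Rightarrow> complex" where
  "zeta d = exp (2 * of_real pi * \<i> / of_nat d)"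

lemma zeta_power: "zeta d ^ k = exp (2 * of_real pi * \<i> * of_nat k / of_nat d)"
  by (simp add: zeta_def exp_of_nat_mult[symmetric] field_simps)

lemma zeta_nonzero [simp]: "zeta d \<noteq> 0"
  by (simp add: zeta_def)

lemma zeta_power_d [simp]: "0 < d \<Longrightarrow> zeta d ^ d = 1"
  by (simp add: zeta_power)

lemma zeta_power_multiple [simp]: "0 < d \<Longrightarrow> zeta d ^ (m * d) = 1" "0 < d \<Longrightarrow> zeta d ^ (d * m) = 1"
  by (simp_all add: power_mult mult.commute[of m])

lemma E_solution_zeta: "E_solution d D k = 1 / of_nat (card D) * (\<Sum>m\<in>D. zeta d ^ (m * k))"
  by (simp add: E_solution_def zeta_power mult.commute)

lemma zeta_orthogonality:
  assumes "a < d" "b < d"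
  shows "(\<Sum>s<d. inverse (zeta d) ^ (a * s) * zeta d ^ (b * s)) = (if a = b then of_nat d else 0)"
proof -
  have d: "0 < d" using assms by simp
  define w where "w = zeta d ^ b / zeta d ^ a"
  have pow: "inverse (zeta d) ^ (a * s) * zeta d ^ (b * s) = w ^ s" for s
    by (simp add: w_def power_mult power_divide power_inverse field_simps)
  have w1: "w = 1 \<longleftrightarrow> a = b"
    using complex_root_unity_eq[of d b a] assms d unfolding w_def zeta_power by auto
  have "w ^ d = 1"
    using d by (simp add: w_def power_divide power_mult[symmetric])
  then have "(\<Sum>s<d. w ^ s) = (if a = b then of_nat d else 0)"
    using w1 by (auto simp: sum_gp_strict)
  then show ?thesis by (simp add: pow)
qed

definition eigenproj :: "nat \<Rightarrow> nat \<Rightarrow> nat \<Rightarrow> free_alg" where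
  "eigenproj d m j =
     scalar (1 / of_nat d) * (\<Sum>s<d. scalar (inverse (zeta d) ^ (m * s)) * gen_t j ^ s)"

fun colour_proj :: "nat \<Rightarrow> nat \<Rightarrow> (nat \<Rightarrow> nat) \<Rightarrow> free_alg" where
  "colour_proj d 0 \<kappa> = 1"
| "colour_proj d (Suc n) \<kappa> = colour_proj d n \<kappa> * eigenproj d (\<kappa> (Suc n)) (Suc n)"

lemma eigenproj_A [simp]: "j \<in> {1..n} \<Longrightarrow> eigenproj d m j \<in> A n"
  unfolding eigenproj_def by (intro A_mult A_sum scalar_A A_power) simp_all

lemma colour_proj_A [simp]: "m \<le> n \<Longrightarrow> colour_proj d m \<kappa> \<in> A n"
  by (induction m) simp_all

lemma colour_proj_cong: "(\<And>j. j \<in> {1..n} \<Longrightarrow> \<kappa> j = \<kappa>' j) \<Longrightarrow> colour_proj d n \<kappa> = colour_proj d n \<kappa>'"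
  by (induction n) auto

lemma sum_eigenproj: "0 < d \<Longrightarrow> (\<Sum>m<d. eigenproj d m j) = 1"
proof -
  assume d: "0 < d"
  have "(\<Sum>m<d. eigenproj d m j) =
      scalar (1 / of_nat d) * (\<Sum>s<d. scalar (\<Sum>m<d. inverse (zeta d) ^ (m * s)) * gen_t j ^ s)"
    unfolding eigenproj_def scalar_sum sum_distrib_left[symmetric] sum_distrib_right
    by (subst sum.swap) simp
  also have "(\<Sum>s<d. scalar (\<Sum>m<d. inverse (zeta d) ^ (m * s)) * gen_t j ^ s) =
      (\<Sum>s<d. if s = 0 then scalar (of_nat d) else 0)"
  proof (rule sum.cong[OF refl])
    fix s assume "s \<in> {..<d}"
    then show "scalar (\<Sum>m<d. inverse (zeta d) ^ (m * s)) * gen_t j ^ s =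
        (if s = 0 then scalar (of_nat d) else 0)"
      using zeta_orthogonality[of s d 0] d by (simp add: mult.commute)
  qed
  also have "\<dots> = scalar (of_nat d)"
    using d by (simp add: sum.delta)
  finally show ?thesis
    using d by (simp add: scalar_simps(5)[symmetric] del: scalar_simps(5))
qed

text \<open>
  Multiplying out the product over \<open>j\<close> of the decompositions of unity given by \<open>sum_eigenproj\<close>.
\<close>

lemma sum_colour_proj: "0 < d \<Longrightarrow> (\<Sum>\<kappa>\<in>{1..n} \<rightarrow>\<^sub>E {..<d}. colour_proj d n \<kappa>) = 1"
proof (induction n)
  case (Suc n)
  have ins: "{1..Suc n} = insert (Suc n) {1..n}" by auto
  have inj: "inj_on (\<lambda>(m, \<kappa>). \<kappa>(Suc n := m)) ({..<d} \<times> ({1..n} \<rightarrow>\<^sub>E {..<d}))"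
    by (rule inj_combinator) simp
  have "(\<Sum>\<kappa>\<in>{1..Suc n} \<rightarrow>\<^sub>E {..<d}. colour_proj d (Suc n) \<kappa>) =
      (\<Sum>(m, \<kappa>)\<in>{..<d} \<times> ({1..n} \<rightarrow>\<^sub>E {..<d}). colour_proj d (Suc n) (\<kappa>(Suc n := m)))"
    unfolding ins PiE_insert_eq by (subst sum.reindex[OF inj]) (simp add: case_prod_unfold)
  also have "\<dots> = (\<Sum>(m, \<kappa>)\<in>{..<d} \<times> ({1..n} \<rightarrow>\<^sub>E {..<d}).
      colour_proj d n \<kappa> * eigenproj d m (Suc n))"
  proof (intro sum.cong refl, clarify)
    fix m \<kappa>
    have "colour_proj d n (\<kappa>(Suc n := m)) = colour_proj d n \<kappa>"
      by (rule colour_proj_cong) auto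
    then show "colour_proj d (Suc n) (\<kappa>(Suc n := m)) = colour_proj d n \<kappa> * eigenproj d m (Suc n)"
      by simp
  qed
  also have "\<dots> = (\<Sum>\<kappa>\<in>{1..n} \<rightarrow>\<^sub>E {..<d}. colour_proj d n \<kappa>) * (\<Sum>m<d. eigenproj d m (Suc n))"
    by (subst sum.cartesian_product[symmetric], subst sum.swap) (simp add: sum_product)
  finally show ?case
    using Suc by (simp add: sum_eigenproj)
qed simp

lemma eigenproj_swap:
  assumes "YH_cong q d (gen_t j * x) (x * gen_t j')"
  shows "YH_cong q d (eigenproj d m j * x) (x * eigenproj d m j')"
  unfolding eigenproj_def
  by (intro YH_cong_swap_scalar YH_cong_commute_sum YH_cong_swap_power assms)

lemma eigenproj_g:
  assumes "i \<ge> 1" "j \<ge> 1"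
  shows "YH_cong q d (eigenproj d m j * gen_g i)
    (gen_g i * eigenproj d m (Transposition.transpose i (i + 1) j))"
  by (intro eigenproj_swap cong_t_g assms)

lemma eigenproj_commute:
  assumes "j \<ge> 1" "k \<ge> 1"
  shows "YH_cong q d (eigenproj d m j * eigenproj d l k) (eigenproj d l k * eigenproj d m j)"
  using assms by (intro eigenproj_swap YH_cong_sym[OF eigenproj_swap] cong_t_commute)

lemma colour_proj_commute:
  assumes "\<And>j. j \<in> {1..n} \<Longrightarrow> YH_cong q d (gen_t j * x) (x * gen_t j)"
  shows "YH_cong q d (colour_proj d n \<kappa> * x) (x * colour_proj d n \<kappa>)"
  using assms by (induction n) (auto intro!: YH_cong_swap eigenproj_swap)

lemma eigen_power:
  assumes "YH_cong q d (t * y) (scalar c * y)"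
  shows "YH_cong q d (t ^ s * y) (scalar (c ^ s) * y)"
proof (induction s)
  case (Suc s)
  have "YH_cong q d (t ^ s * (t * y)) (t ^ s * (scalar c * y))"
    by (intro YH_cong_lmult assms)
  also have "t ^ s * (scalar c * y) = scalar c * (t ^ s * y)"
    by (rule scalar_left_commute)
  also have "YH_cong q d \<dots> (scalar c * (scalar (c ^ s) * y))"
    by (intro YH_cong_lmult Suc)
  finally have "YH_cong q d (t ^ s * (t * y)) (scalar c * (scalar (c ^ s) * y))" .
  moreover have "t ^ Suc s * y = t ^ s * (t * y)"
    by (simp only: power_Suc2 mult.assoc)
  ultimately show ?case by (simp add: mult.assoc)
qed simp

text \<open>
  Multiplication by \<open>gen_t j\<close> shifts the summation index cyclically, since \<open>gen_t j ^ d\<close> is congruent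
  to \<open>1\<close>.
\<close>

lemma t_eigenproj:
  assumes "0 < d" "j \<ge> 1"
  shows "YH_cong q d (gen_t j * eigenproj d m j) (scalar (zeta d ^ m) * eigenproj d m j)"
proof -
  define c where "c s = inverse (zeta d) ^ (m * s)" for s
  have step: "c s = zeta d ^ m * c (Suc s)" for s
    by (simp add: c_def power_add field_simps)
  have "gen_t j * eigenproj d m j =
      scalar (1 / of_nat d) * (\<Sum>s<d. scalar (c s) * gen_t j ^ Suc s)"
    unfolding eigenproj_def c_def[symmetric]
    by (simp add: scalar_left_commute[of "gen_t j"] sum_distrib_left[of "gen_t j"] del: scalar_simps)
  also have "(\<Sum>s<d. scalar (c s) * gen_t j ^ Suc s) =
      scalar (zeta d ^ m) * (\<Sum>s<d. scalar (c (Suc s)) * gen_t j ^ Suc s)"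
    unfolding sum_distrib_left
  proof (intro sum.cong refl)
    fix s
    show "scalar (c s) * gen_t j ^ Suc s = scalar (zeta d ^ m) * (scalar (c (Suc s)) * gen_t j ^ Suc s)"
      by (subst step) (simp add: mult.assoc)
  qed
  also have "YH_cong q d (scalar (1 / of_nat d) * (scalar (zeta d ^ m) * (\<Sum>s<d. scalar (c (Suc s)) * gen_t j ^ Suc s)))
      (scalar (1 / of_nat d) * (scalar (zeta d ^ m) * (\<Sum>s<d. scalar (c s) * gen_t j ^ s)))"
  proof (intro YH_cong_lmult)
    have "(\<Sum>s<d. scalar (c (Suc s)) * gen_t j ^ Suc s) =
        (\<Sum>s<d. scalar (c s) * gen_t j ^ s) + (scalar (c d) * gen_t j ^ d - scalar (c 0))"
      using sum.lessThan_Suc[of "\<lambda>s. scalar (c s) * gen_t j ^ s" d]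
        sum.lessThan_Suc_shift[of "\<lambda>s. scalar (c s) * gen_t j ^ s" d]
      by (simp add: algebra_simps)
    also have "\<dots> = (\<Sum>s<d. scalar (c s) * gen_t j ^ s) + (scalar 1 * gen_t j ^ d - scalar 1)"
      using assms by (simp add: c_def power_inverse)
    also have "YH_cong q d ((\<Sum>s<d. scalar (c s) * gen_t j ^ s) + (scalar 1 * gen_t j ^ d - scalar 1))
        ((\<Sum>s<d. scalar (c s) * gen_t j ^ s) + (scalar 1 * 1 - scalar 1))"
      by (intro YH_cong_add YH_cong_refl YH_cong_diff YH_cong_lmult cong_t_power assms)
    finally show "YH_cong q d (\<Sum>s<d. scalar (c (Suc s)) * gen_t j ^ Suc s) (\<Sum>s<d. scalar (c s) * gen_t j ^ s)"
      by simp
  qed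
  also have "\<dots> = scalar (zeta d ^ m) * eigenproj d m j"
    unfolding eigenproj_def c_def[symmetric] by (rule scalar_left_commute)
  finally show ?thesis .
qed

lemma t_colour_proj:
  assumes "0 < d" "j \<in> {1..n}"
  shows "YH_cong q d (gen_t j * colour_proj d n \<kappa>) (scalar (zeta d ^ \<kappa> j) * colour_proj d n \<kappa>)"
  using assms(2)
proof (induction n)
  case (Suc n)
  show ?case
  proof (cases "j = Suc n")
    case True
    have "YH_cong q d (gen_t j * colour_proj d n \<kappa> * eigenproj d (\<kappa> j) j)
        (colour_proj d n \<kappa> * gen_t j * eigenproj d (\<kappa> j) j)"
      using Suc.prems by (intro YH_cong_rmult YH_cong_sym[OF colour_proj_commute] cong_t_commute) auto
    also have "YH_cong q d (colour_proj d n \<kappa> * gen_t j * eigenproj d (\<kappa> j) j)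
        (colour_proj d n \<kappa> * (scalar (zeta d ^ \<kappa> j) * eigenproj d (\<kappa> j) j))"
      unfolding mult.assoc using Suc.prems assms by (intro YH_cong_lmult t_eigenproj) auto
    finally show ?thesis
      using True by (simp add: mult.assoc scalar_left_commute)
  next
    case False
    then have "YH_cong q d (gen_t j * colour_proj d n \<kappa>) (scalar (zeta d ^ \<kappa> j) * colour_proj d n \<kappa>)"
      using Suc by simp
    from YH_cong_rmult[OF this, of "eigenproj d (\<kappa> (Suc n)) (Suc n)"] show ?thesis
      by (simp add: mult.assoc)
  qed
qed simp

lemma t_power_colour_proj:
  assumes "0 < d" "j \<in> {1..n}"
  shows "YH_cong q d (gen_t j ^ s * colour_proj d n \<kappa>) (scalar (zeta d ^ (\<kappa> j * s)) * colour_proj d n \<kappa>)"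
  using eigen_power[OF t_colour_proj[OF assms]] by (simp add: power_mult)

lemma eigenproj_colour_proj:
  assumes "j \<in> {1..n}" "m < d" "\<kappa> j < d"
  shows "YH_cong q d (eigenproj d m j * colour_proj d n \<kappa>) (if \<kappa> j = m then colour_proj d n \<kappa> else 0)"
proof -
  have d: "0 < d" using assms by simp
  let ?P = "colour_proj d n \<kappa>"
  have expand: "eigenproj d m j * ?P =
      scalar (1 / of_nat d) * (\<Sum>s<d. scalar (inverse (zeta d) ^ (m * s)) * (gen_t j ^ s * ?P))"
    by (simp add: eigenproj_def sum_distrib_right mult.assoc)
  have step: "YH_cong q d
      (scalar (1 / of_nat d) * (\<Sum>s<d. scalar (inverse (zeta d) ^ (m * s)) * (gen_t j ^ s * ?P)))
      (scalar (1 / of_nat d) * (\<Sum>s<d. scalar (inverse (zeta d) ^ (m * s)) * (scalar (zeta d ^ (\<kappa> j * s)) * ?P)))"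
    using assms d by (intro YH_cong_lmult YH_cong_sum t_power_colour_proj) auto
  have "scalar (1 / of_nat d) *
      (\<Sum>s<d. scalar (inverse (zeta d) ^ (m * s)) * (scalar (zeta d ^ (\<kappa> j * s)) * ?P)) =
    scalar (1 / of_nat d * (\<Sum>s<d. inverse (zeta d) ^ (m * s) * zeta d ^ (\<kappa> j * s))) * ?P"
    by (simp only: scalar_simps scalar_sum sum_distrib_right sum_distrib_left mult.assoc)
  also have "\<dots> = (if \<kappa> j = m then ?P else 0)"
    using assms d by (subst zeta_orthogonality) auto
  finally show ?thesis
    using step by (simp only: expand)
qed

text \<open>
  This is where the dependence on \<open>d\<close> disappears: on a coloured element the idempotent is \<open>1\<close> or \<open>0\<close>,
  according to whether the two strands have the same colour.
\<close>

lemma idem_e_colour_proj: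
  assumes "i \<in> {1..<n}" "\<kappa> i < d" "\<kappa> (i + 1) < d"
  shows "YH_cong q d (idem_e d i * colour_proj d n \<kappa>)
    (if \<kappa> i = \<kappa> (i + 1) then colour_proj d n \<kappa> else 0)"
proof -
  have d: "0 < d" using assms by simp
  let ?P = "colour_proj d n \<kappa>"
  let ?a = "\<kappa> i" and ?b = "\<kappa> (i + 1)"
  have expand: "idem_e d i * ?P =
      scalar (1 / of_nat d) * (\<Sum>s<d. gen_t i ^ s * (gen_t (i + 1) ^ (d - s) * ?P))"
    by (simp add: idem_e_def sum_distrib_right mult.assoc)
  have step: "YH_cong q d (scalar (1 / of_nat d) * (\<Sum>s<d. gen_t i ^ s * (gen_t (i + 1) ^ (d - s) * ?P)))
      (scalar (1 / of_nat d) * (\<Sum>s<d. scalar (zeta d ^ (?b * (d - s))) * (scalar (zeta d ^ (?a * s)) * ?P)))"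
  proof (rule YH_cong_lmult, rule YH_cong_sum)
    fix s
    let ?c = "scalar (zeta d ^ (?b * (d - s)))"
    have "YH_cong q d (gen_t i ^ s * (gen_t (i + 1) ^ (d - s) * ?P)) (gen_t i ^ s * (?c * ?P))"
      using assms d by (intro YH_cong_lmult t_power_colour_proj) auto
    moreover have "YH_cong q d (?c * (gen_t i ^ s * ?P)) (?c * (scalar (zeta d ^ (?a * s)) * ?P))"
      using assms d by (intro YH_cong_lmult t_power_colour_proj) auto
    ultimately show "YH_cong q d (gen_t i ^ s * (gen_t (i + 1) ^ (d - s) * ?P))
        (?c * (scalar (zeta d ^ (?a * s)) * ?P))"
      unfolding scalar_left_commute[of "gen_t i ^ s"] by (rule YH_cong_trans)
  qed
  have "scalar (1 / of_nat d) *
      (\<Sum>s<d. scalar (zeta d ^ (?b * (d - s))) * (scalar (zeta d ^ (?a * s)) * ?P)) =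
    scalar (1 / of_nat d * (\<Sum>s<d. zeta d ^ (?b * (d - s)) * zeta d ^ (?a * s))) * ?P"
    by (simp only: scalar_simps scalar_sum sum_distrib_right sum_distrib_left mult.assoc)
  also have "(\<Sum>s<d. zeta d ^ (?b * (d - s)) * zeta d ^ (?a * s)) =
      (\<Sum>s<d. inverse (zeta d) ^ (?b * s) * zeta d ^ (?a * s))"
  proof (intro sum.cong refl)
    fix s assume "s \<in> {..<d}"
    then have "zeta d ^ (?b * (d - s)) * zeta d ^ (?b * s) = 1"
      using d by (simp add: power_add[symmetric] distrib_left[symmetric])
    then show "zeta d ^ (?b * (d - s)) * zeta d ^ (?a * s) =
        inverse (zeta d) ^ (?b * s) * zeta d ^ (?a * s)"
      by (simp add: power_inverse field_simps)
  qed
  also have "scalar (1 / of_nat d * \<dots>) * ?P = (if ?a = ?b then ?P else 0)"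
    using assms d by (subst zeta_orthogonality) auto
  finally show ?thesis
    using step by (simp only: expand)
qed

text \<open>
  Crossing two adjacent strands exchanges their colours. Only the two factors of adjacent index are
  affected; after the exchange they have to be put back into increasing order.
\<close>

lemma colour_proj_g:
  assumes "1 \<le> i" "i < n"
  shows "YH_cong q d (colour_proj d n \<kappa> * gen_g i)
    (gen_g i * colour_proj d n (\<kappa> \<circ> Transposition.transpose i (i + 1)))"
  using assms(2)
proof (induction n)
  case (Suc n)
  let ?s = "Transposition.transpose i (i + 1)"
  show ?case
  proof (cases "n = i")
    case True
    define k where "k = i - 1"
    have i: "i = Suc k" using assms by (simp add: k_def)
    let ?P = "colour_proj d k \<kappa>"
    let ?a = "eigenproj d (\<kappa> i) (i + 1)" and ?b = "eigenproj d (\<kappa> (i + 1)) i"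
    have P: "colour_proj d k (\<kappa> \<circ> ?s) = ?P"
      by (rule colour_proj_cong) (auto simp: i Transposition.transpose_def)
    have "YH_cong q d (?P * eigenproj d (\<kappa> i) i * eigenproj d (\<kappa> (i + 1)) (i + 1) * gen_g i)
        (gen_g i * (?P * ?a * ?b))"
    proof (intro YH_cong_swap)
      show "YH_cong q d (?P * gen_g i) (gen_g i * ?P)"
      proof (rule colour_proj_commute)
        fix j assume "j \<in> {1..k}"
        then show "YH_cong q d (gen_t j * gen_g i) (gen_g i * gen_t j)"
          using cong_t_g[of i j q d] by (simp add: i Transposition.transpose_def)
      qed
      show "YH_cong q d (eigenproj d (\<kappa> i) i * gen_g i) (gen_g i * ?a)"
        using eigenproj_g[of i i] assms by simp
      show "YH_cong q d (eigenproj d (\<kappa> (i + 1)) (i + 1) * gen_g i) (gen_g i * ?b)"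
        using eigenproj_g[of i "i + 1"] assms by simp
    qed
    also have "YH_cong q d (gen_g i * (?P * ?a * ?b)) (gen_g i * (?P * ?b * ?a))"
      unfolding mult.assoc using assms by (intro YH_cong_lmult eigenproj_commute) auto
    finally show ?thesis
      using P i by (simp add: \<open>n = i\<close> comp_def)
  next
    case False
    then have lt: "i < n" using Suc.prems by simp
    then have fixed: "?s (Suc n) = Suc n" by (simp add: Transposition.transpose_def)
    have "YH_cong q d (colour_proj d n \<kappa> * eigenproj d (\<kappa> (Suc n)) (Suc n) * gen_g i)
       (gen_g i * (colour_proj d n (\<kappa> \<circ> ?s) * eigenproj d (\<kappa> (Suc n)) (Suc n)))"
      using Suc.IH[OF lt] eigenproj_g[of i "Suc n" q d "\<kappa> (Suc n)"] assms(1) fixed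
      by (intro YH_cong_swap) (simp_all add: comp_def)
    then show ?thesis
      using fixed by (simp add: comp_def)
  qed
qed simp

section \<open>Reduction of braids on a coloured element\<close>

definition braid_eval :: "complex \<Rightarrow> nat \<Rightarrow> braid_word \<Rightarrow> free_alg" where
  "braid_eval q d w = prod_list (map (\<lambda>(i, s). if s then gen_g i else g_inverse q d i) w)"

lemma braid_eval_simps [simp]:
  "braid_eval q d [] = 1"
  "braid_eval q d (u @ v) = braid_eval q d u * braid_eval q d v"
  "braid_eval q d [(i, s)] = (if s then gen_g i else g_inverse q d i)"
  by (simp_all add: braid_eval_def)

lemma braid_words_simps [simp]:
  "[] \<in> braid_words n"
  "u @ v \<in> braid_words n \<longleftrightarrow> u \<in> braid_words n \<and> v \<in> braid_words n"
  "(i, s) # w \<in> braid_words n \<longleftrightarrow> i \<in> {1..<n} \<and> w \<in> braid_words n"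
  by (auto simp: braid_words_def)

text \<open>
  \<open>descent n k\<close> is the product of \<open>gen_g n, \<dots>, gen_g k\<close> with decreasing indices. These are the minimal
  representatives of the right cosets of the symmetric group on \<open>n\<close> letters in that on \<open>n + 1\<close> letters;
  \<open>k = n + 1\<close> gives the trivial coset.
\<close>

fun descent :: "nat \<Rightarrow> nat \<Rightarrow> free_alg" where
  "descent 0 k = 1"
| "descent (Suc n) k = (if k \<le> Suc n then gen_g (Suc n) * descent n k else 1)"

lemma descent_above [simp]: "n < k \<Longrightarrow> descent n k = 1"
  by (cases n) simp_all

lemma descent_unfold_right: "1 \<le> k \<Longrightarrow> k \<le> n \<Longrightarrow> descent n k = descent n (Suc k) * gen_g k"
proof (induction n)
  case (Suc n)
  then show ?case by (cases "k = Suc n") (simp_all add: mult.assoc)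
qed simp

lemma YH_cong_in_context:
  "YH_cong q d a b \<Longrightarrow> p = u * a * v \<Longrightarrow> r = u * b * v \<Longrightarrow> YH_cong q d p r"
  by (simp add: YH_cong_mult)

lemma YH_cong_commute_mult:
  assumes "YH_cong q d (x * a) (a' * x)" "YH_cong q d (y * a') (b * y)"
  shows "YH_cong q d (y * x * a) (b * (y * x))"
proof (rule YH_cong_trans)
  show "YH_cong q d (y * x * a) (y * a' * x)"
    using YH_cong_lmult[OF assms(1), of y] by (simp add: mult.assoc)
  show "YH_cong q d (y * a' * x) (b * (y * x))"
    using YH_cong_rmult[OF assms(2), of x] by (simp add: mult.assoc)
qed

lemma descent_g_below:
  assumes "1 \<le> i" "i + 1 < k"
  shows "YH_cong q d (descent n k * gen_g i) (gen_g i * descent n k)"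
proof (induction n)
  case (Suc n)
  show ?case
  proof (cases "k \<le> Suc n")
    case True
    then show ?thesis
      using assms by (auto intro!: YH_cong_commute_mult[OF Suc] cong_far)
  qed simp
qed simp

lemma descent_g_above:
  assumes "n + 1 < i"
  shows "YH_cong q d (descent n k * gen_g i) (gen_g i * descent n k)"
  using assms
proof (induction n)
  case (Suc n)
  have IH: "YH_cong q d (descent n k * gen_g i) (gen_g i * descent n k)"
    using Suc by simp
  show ?case
    using Suc.prems by (auto intro!: YH_cong_commute_mult[OF IH] cong_far)
qed simp

lemma descent_g_within:
  assumes "1 \<le> k" "k < i" "i \<le> n"
  shows "YH_cong q d (descent n k * gen_g i) (gen_g (i - 1) * descent n k)"
  using assms
proof (induction n)
  case (Suc n)
  show ?case
  proof (cases "i \<le> n")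
    case True
    have IH: "YH_cong q d (descent n k * gen_g i) (gen_g (i - 1) * descent n k)"
      using Suc True by simp
    have "YH_cong q d (gen_g (Suc n) * gen_g (i - 1)) (gen_g (i - 1) * gen_g (Suc n))"
      using Suc.prems True by (intro cong_far) auto
    from YH_cong_commute_mult[OF IH this] show ?thesis
      using Suc.prems by simp
  next
    case False
    then have i: "i = Suc n" using Suc.prems by simp
    obtain m where m: "n = Suc m" using Suc.prems i by (cases n) auto
    let ?a = "gen_g i" and ?b = "gen_g n"
    have D: "descent (Suc n) k = ?a * ?b * descent m k"
      using Suc.prems i m by (simp add: mult.assoc)
    have "YH_cong q d (?a * ?b * (descent m k * ?a)) (?a * ?b * (?a * descent m k))"
      using i m by (intro YH_cong_lmult descent_g_above) simp
    moreover have "YH_cong q d (?a * ?b * ?a * descent m k) (?b * ?a * ?b * descent m k)"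
      using Suc.prems i by (intro YH_cong_rmult cong_braid) auto
    ultimately have "YH_cong q d (?a * ?b * (descent m k * ?a)) (?b * ?a * ?b * descent m k)"
      unfolding mult.assoc by (rule YH_cong_trans)
    then show ?thesis
      unfolding D using i by (simp add: mult.assoc)
  qed
qed simp

lemma t_descent:
  assumes "1 \<le> k" "k \<le> Suc n"
  shows "YH_cong q d (gen_t (Suc n) * descent n k) (descent n k * gen_t k)"
  using assms
proof (induction n)
  case (Suc n)
  show ?case
  proof (cases "k = Suc (Suc n)")
    case False
    have IH: "YH_cong q d (gen_t (Suc n) * descent n k) (descent n k * gen_t k)"
      using Suc False by simp
    have "YH_cong q d (gen_t (Suc (Suc n)) * gen_g (Suc n)) (gen_g (Suc n) * gen_t (Suc n))"
      using cong_t_g[of "Suc n" "Suc (Suc n)" q d] by simp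
    from YH_cong_rmult[OF this, of "descent n k"] YH_cong_lmult[OF IH, of "gen_g (Suc n)"]
    have "YH_cong q d (gen_t (Suc (Suc n)) * (gen_g (Suc n) * descent n k))
        (gen_g (Suc n) * (descent n k * gen_t k))"
      unfolding mult.assoc by (rule YH_cong_trans)
    then show ?thesis
      using False Suc.prems by (simp add: mult.assoc)
  qed simp
qed simp

text \<open>
  The relation \<open>R\<close> is the pattern of a colouring: it records which strands have equal colours, but not
  the colours, and it makes sense for all \<open>d\<close> at once.
\<close>

definition coloured :: "nat \<Rightarrow> nat \<Rightarrow> (nat \<Rightarrow> nat \<Rightarrow> bool) \<Rightarrow> (nat \<Rightarrow> nat) \<Rightarrow> bool" where
  "coloured d n R \<kappa> \<longleftrightarrow> (\<forall>j\<in>{1..n}. \<kappa> j < d) \<and> (\<forall>i\<in>{1..n}. \<forall>j\<in>{1..n}. \<kappa> i = \<kappa> j \<longleftrightarrow> R i j)"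

text \<open>
  Families of elements, indexed by \<open>d\<close> and a colouring with pattern \<open>R\<close>, that are linear combinations
  of normal forms with coefficients depending neither on \<open>d\<close> nor on the colouring. A normal form
  consists of a braid on one strand less, a coset representative and the colouring. The rule \<open>cong\<close>
  passes to the quotient; it may use the pattern.
\<close>

inductive reducible ::
  "complex \<Rightarrow> nat \<Rightarrow> (nat \<Rightarrow> nat \<Rightarrow> bool) \<Rightarrow> (nat \<Rightarrow> (nat \<Rightarrow> nat) \<Rightarrow> free_alg) \<Rightarrow> bool"
  for q n R where
  normal: "\<lbrakk>x \<in> braid_words n; 1 \<le> k; k \<le> Suc n\<rbrakk> \<Longrightarrow>
    reducible q n R (\<lambda>d \<kappa>. braid_eval q d x * descent n k * colour_proj d (Suc n) \<kappa>)"
| add: "\<lbrakk>reducible q n R f; reducible q n R h\<rbrakk> \<Longrightarrow> reducible q n R (\<lambda>d \<kappa>. f d \<kappa> + h d \<kappa>)"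
| scale: "reducible q n R f \<Longrightarrow> reducible q n R (\<lambda>d \<kappa>. scalar c * f d \<kappa>)"
| cong: "\<lbrakk>reducible q n R f;
    \<And>d \<kappa>. coloured d (Suc n) R \<kappa> \<Longrightarrow> YH_cong q d (f d \<kappa>) (h d \<kappa>)\<rbrakk> \<Longrightarrow> reducible q n R h"

text \<open>
  The four cases are the action of a simple transposition on the coset of \<open>descent n k\<close>. It either
  fixes the coset, and then a generator of index less than \<open>n\<close> comes out on the left, or it moves the
  coset to a neighbour. For \<open>k = i\<close> the length drops and the quadratic relation is needed; its
  correction term contains an idempotent, which the colouring evaluates.
\<close>

lemma reducible_normal_g:
  assumes x: "x \<in> braid_words n" and k: "1 \<le> k" "k \<le> Suc n" and i: "1 \<le> i" "i \<le> n"
  shows "reducible q n R (\<lambda>d \<kappa>. braid_eval q d x * descent n k * gen_g i * colour_proj d (Suc n) \<kappa>)"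
proof -
  consider "i + 1 < k" | "k = Suc i" | "k = i" | "k < i" by linarith
  then show ?thesis
  proof cases
    case 1
    show ?thesis
    proof (rule reducible.cong)
      show "reducible q n R (\<lambda>d \<kappa>. braid_eval q d (x @ [(i, True)]) * descent n k * colour_proj d (Suc n) \<kappa>)"
        using x k i 1 by (intro reducible.normal) auto
      fix d \<kappa>
      show "YH_cong q d (braid_eval q d (x @ [(i, True)]) * descent n k * colour_proj d (Suc n) \<kappa>)
          (braid_eval q d x * descent n k * gen_g i * colour_proj d (Suc n) \<kappa>)"
        by (rule YH_cong_in_context[OF YH_cong_sym[OF descent_g_below[OF i(1) 1]]])
          (simp_all add: mult.assoc)
    qed
  next
    case 2
    then have "descent n k * gen_g i = descent n i"
      using descent_unfold_right[of i n] i by simp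
    then show ?thesis
      using reducible.normal[of x n i q R] x i by (simp add: mult.assoc)
  next
    case 3
    let ?P = "\<lambda>d. colour_proj d (Suc n)"
    let ?B = "\<lambda>d. braid_eval q d x"
    show ?thesis
    proof (rule reducible.cong)
      show "reducible q n R (\<lambda>d \<kappa>. ?B d * descent n (Suc k) * ?P d \<kappa> +
          scalar (if R k (Suc k) then q - inverse q else 0) * (?B d * descent n k * ?P d \<kappa>))"
        using x k i 3 by (intro reducible.add reducible.scale reducible.normal) auto
      fix d \<kappa>
      assume col: "coloured d (Suc n) R \<kappa>"
      let ?u = "?B d * descent n (Suc k)" and ?c = "scalar (q - inverse q)"
      have "YH_cong q d (gen_g k * gen_g k * ?P d \<kappa>)
          ((1 + ?c * idem_e d k * gen_g k) * ?P d \<kappa>)"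
        using k by (intro YH_cong_rmult cong_g_square)
      also have "YH_cong q d ((1 + ?c * idem_e d k * gen_g k) * ?P d \<kappa>)
          (?P d \<kappa> + ?c * (gen_g k * idem_e d k * ?P d \<kappa>))"
        using YH_cong_add[OF YH_cong_refl YH_cong_lmult[OF YH_cong_rmult[OF cong_e_g]]] k
        by (simp add: distrib_right mult.assoc del: scalar_simps)
      also have "YH_cong q d (?P d \<kappa> + ?c * (gen_g k * idem_e d k * ?P d \<kappa>))
          (?P d \<kappa> + ?c * (gen_g k * (if \<kappa> k = \<kappa> (k + 1) then ?P d \<kappa> else 0)))"
        unfolding mult.assoc using col 3 i
        by (intro YH_cong_add YH_cong_refl YH_cong_lmult idem_e_colour_proj)
          (auto simp: coloured_def)
      finally have "YH_cong q d (gen_g k * gen_g k * ?P d \<kappa>)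
          (?P d \<kappa> + ?c * (gen_g k * (if \<kappa> k = \<kappa> (k + 1) then ?P d \<kappa> else 0)))" .
      moreover have "\<kappa> k = \<kappa> (k + 1) \<longleftrightarrow> R k (Suc k)"
        using col 3 i by (auto simp: coloured_def)
      ultimately have "YH_cong q d (?u * (gen_g k * gen_g k * ?P d \<kappa>))
          (?u * (?P d \<kappa> + ?c * (gen_g k * (if R k (Suc k) then ?P d \<kappa> else 0))))"
        by (simp add: YH_cong_lmult del: scalar_simps)
      moreover have D: "descent n k = descent n (Suc k) * gen_g k"
        using descent_unfold_right[of k n] k i 3 by simp
      have "?u * (gen_g k * gen_g k * ?P d \<kappa>) = ?B d * descent n k * gen_g i * ?P d \<kappa>"
        unfolding 3[symmetric] D by (simp only: mult.assoc)
      moreover have "?u * (?P d \<kappa> + ?c * (gen_g k * (if R k (Suc k) then ?P d \<kappa> else 0))) =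
          ?u * ?P d \<kappa> +
          scalar (if R k (Suc k) then q - inverse q else 0) * (?B d * descent n k * ?P d \<kappa>)"
      proof (cases "R k (Suc k)")
        case True
        have "?u * (?c * (gen_g k * ?P d \<kappa>)) = ?c * (?B d * descent n k * ?P d \<kappa>)"
          unfolding scalar_left_commute[of ?u] D by (simp only: mult.assoc)
        with True show ?thesis by (simp only: if_True distrib_left)
      qed simp
      ultimately show "YH_cong q d (?u * ?P d \<kappa> +
          scalar (if R k (Suc k) then q - inverse q else 0) * (?B d * descent n k * ?P d \<kappa>))
          (?B d * descent n k * gen_g i * ?P d \<kappa>)"
        by (metis YH_cong_sym)
    qed
  next
    case 4
    show ?thesis
    proof (rule reducible.cong)
      show "reducible q n R (\<lambda>d \<kappa>. braid_eval q d (x @ [(i - 1, True)]) * descent n k * colour_proj d (Suc n) \<kappa>)"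
        using x k i 4 by (intro reducible.normal) auto
      fix d \<kappa>
      show "YH_cong q d (braid_eval q d (x @ [(i - 1, True)]) * descent n k * colour_proj d (Suc n) \<kappa>)
          (braid_eval q d x * descent n k * gen_g i * colour_proj d (Suc n) \<kappa>)"
        by (rule YH_cong_in_context[OF YH_cong_sym[OF descent_g_within[OF k(1) 4 i(2)]]])
          (simp_all add: mult.assoc)
    qed
  qed
qed

lemma coloured_transpose:
  assumes "coloured d (Suc n) R \<kappa>" "1 \<le> i" "i \<le> n"
  shows "coloured d (Suc n) (\<lambda>a b. R (Transposition.transpose i (i + 1) a) (Transposition.transpose i (i + 1) b))
    (\<kappa> \<circ> Transposition.transpose i (i + 1))"
proof -
  have "Transposition.transpose i (i + 1) j \<in> {1..Suc n}" if "j \<in> {1..Suc n}" for j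
    using that assms by (auto simp: Transposition.transpose_def)
  then show ?thesis
    using assms(1) unfolding coloured_def by simp
qed

text \<open>
  Moving \<open>gen_g i\<close> to the left through the colouring transposes two colours, hence the transposed
  pattern in the premise.
\<close>

lemma reducible_mult_g:
  assumes "reducible q n (\<lambda>a b. R (Transposition.transpose i (i + 1) a) (Transposition.transpose i (i + 1) b)) f"
    and i: "1 \<le> i" "i \<le> n"
  shows "reducible q n R (\<lambda>d \<kappa>. f d (\<kappa> \<circ> Transposition.transpose i (i + 1)) * gen_g i)"
  using assms(1)
proof (induction rule: reducible.induct)
  case (normal x k)
  let ?s = "Transposition.transpose i (i + 1)"
  show ?case
  proof (rule reducible.cong[OF reducible_normal_g[OF normal i]])
    fix d and \<kappa> :: "nat \<Rightarrow> nat"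
    have "\<kappa> \<circ> ?s \<circ> ?s = \<kappa>" by (simp add: comp_assoc)
    then have swap: "YH_cong q d (colour_proj d (Suc n) (\<kappa> \<circ> ?s) * gen_g i) (gen_g i * colour_proj d (Suc n) \<kappa>)"
      using colour_proj_g[of i "Suc n" q d "\<kappa> \<circ> ?s"] i by (simp del: colour_proj.simps)
    show "YH_cong q d (braid_eval q d x * descent n k * gen_g i * colour_proj d (Suc n) \<kappa>)
        (braid_eval q d x * descent n k * colour_proj d (Suc n) (\<kappa> \<circ> ?s) * gen_g i)"
      unfolding mult.assoc by (rule YH_cong_lmult[OF YH_cong_lmult[OF YH_cong_sym[OF swap]]])
  qed
next
  case (add f h)
  from reducible.add[OF add.IH] show ?case by (simp only: distrib_right)
next
  case (scale f c)
  from reducible.scale[OF scale.IH, where c = c] show ?case by (simp only: mult.assoc)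
next
  case (cong f h)
  show ?case
    by (rule reducible.cong[OF cong.IH])
      (intro YH_cong_rmult cong.hyps coloured_transpose i)
qed

lemma reducible_braid:
  assumes "w \<in> braid_words (Suc n)"
  shows "reducible q n R (\<lambda>d \<kappa>. braid_eval q d w * colour_proj d (Suc n) \<kappa>)"
  using assms
proof (induction w arbitrary: R rule: rev_induct)
  case Nil
  from reducible.normal[of "[]" n "Suc n" q R] show ?case by simp
next
  case (snoc l w)
  obtain i s where l: "l = (i, s)" by (cases l)
  have i: "1 \<le> i" "i \<le> n" and w: "w \<in> braid_words (Suc n)" using snoc.prems l by auto
  let ?s = "Transposition.transpose i (i + 1)" and ?P = "\<lambda>d. colour_proj d (Suc n)"
  have g: "reducible q n R (\<lambda>d \<kappa>. braid_eval q d w * gen_g i * ?P d \<kappa>)"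
  proof (rule reducible.cong[OF reducible_mult_g[OF snoc.IH[OF w] i]])
    fix d and \<kappa> :: "nat \<Rightarrow> nat"
    have "\<kappa> \<circ> ?s \<circ> ?s = \<kappa>" by (simp add: comp_assoc)
    then have "YH_cong q d (?P d (\<kappa> \<circ> ?s) * gen_g i) (gen_g i * ?P d \<kappa>)"
      using colour_proj_g[of i "Suc n" q d "\<kappa> \<circ> ?s"] i by (simp del: colour_proj.simps)
    then show "YH_cong q d (braid_eval q d w * ?P d (\<kappa> \<circ> ?s) * gen_g i)
        (braid_eval q d w * gen_g i * ?P d \<kappa>)"
      unfolding mult.assoc by (rule YH_cong_lmult)
  qed
  show ?case
  proof (cases s)
    case True
    with g l show ?thesis by simp
  next
    case False
    \<comment> \<open>The inverse differs from the generator by a multiple of the idempotent, which the colouring evaluates.\<close>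
    let ?c = "if R i (i + 1) then - (q - inverse q) else 0"
    show ?thesis
    proof (rule reducible.cong[OF reducible.add[OF g reducible.scale[OF snoc.IH[OF w], where c = ?c]]])
      fix d \<kappa>
      assume col: "coloured d (Suc n) R \<kappa>"
      have R: "\<kappa> i = \<kappa> (i + 1) \<longleftrightarrow> R i (i + 1)"
        using col i by (auto simp: coloured_def)
      let ?B = "braid_eval q d w"
      have "YH_cong q d (?B * gen_g i * ?P d \<kappa> - scalar (q - inverse q) * (?B * (idem_e d i * ?P d \<kappa>)))
        (?B * gen_g i * ?P d \<kappa> - scalar (q - inverse q) *
          (?B * (if \<kappa> i = \<kappa> (i + 1) then ?P d \<kappa> else 0)))"
        using col i by (intro YH_cong_diff YH_cong_refl YH_cong_lmult idem_e_colour_proj)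
          (auto simp: coloured_def)
      also have "?B * gen_g i * ?P d \<kappa> - scalar (q - inverse q) *
          (?B * (if \<kappa> i = \<kappa> (i + 1) then ?P d \<kappa> else 0)) =
          ?B * gen_g i * ?P d \<kappa> + scalar ?c * (?B * ?P d \<kappa>)"
        using R by (simp add: algebra_simps)
      also have "?B * gen_g i * ?P d \<kappa> - scalar (q - inverse q) * (?B * (idem_e d i * ?P d \<kappa>)) =
          braid_eval q d (w @ [l]) * ?P d \<kappa>"
        using l False by (simp add: g_inverse_def left_diff_distrib right_diff_distrib mult.assoc
            scalar_left_commute[of ?B] del: scalar_simps)
      finally show "YH_cong q d (?B * gen_g i * ?P d \<kappa> + scalar ?c * (?B * ?P d \<kappa>))
          (braid_eval q d (w @ [l]) * ?P d \<kappa>)"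
        by (rule YH_cong_sym)
    qed
  qed
qed

section \<open>Traces of coloured braids\<close>

text \<open>
  The specialized trace as a functional on all of \<open>free_alg\<close>, regardless of levels.
\<close>

locale markov_trace =
  fixes q :: complex and d :: nat and D :: "nat set" and \<tau> :: "free_alg \<Rightarrow> complex poly"
  assumes d_pos: "0 < d"
    and D: "residue_subset d D"
    and trace_add: "\<tau> (a + b) = \<tau> a + \<tau> b"
    and trace_scalar: "\<tau> (scalar c * a) = Polynomial.smult c (\<tau> a)"
    and trace_commute: "\<tau> (a * b) = \<tau> (b * a)"
    and trace_one: "\<tau> 1 = 1"
    and trace_g: "n \<ge> 1 \<Longrightarrow> a \<in> A n \<Longrightarrow> \<tau> (a * gen_g n) = [:0, 1:] * \<tau> a"
    and trace_t: "a \<in> A n \<Longrightarrow> k \<in> {1..<d} \<Longrightarrow>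
      \<tau> (a * gen_t (n + 1) ^ k) = Polynomial.smult (E_solution d D k) (\<tau> a)"
    and trace_cong: "YH_cong q d a b \<Longrightarrow> \<tau> a = \<tau> b"

lemma g_inverse_A [simp]: "i \<in> {1..<n} \<Longrightarrow> g_inverse q d i \<in> A n"
  unfolding g_inverse_def by (simp del: scalar_simps)

lemma braid_eval_A: "w \<in> braid_words n \<Longrightarrow> braid_eval q d w \<in> A n"
proof (induction w)
  case (Cons l w)
  then show ?case by (cases l) (simp add: braid_eval_def)
qed (simp add: braid_eval_def)

lemma descent_word:
  assumes "1 \<le> k"
  shows "\<exists>y\<in>braid_words (Suc m). \<forall>q d. braid_eval q d y = descent m k"
proof (intro bexI allI)
  fix q d
  show "braid_eval q d (map (\<lambda>i. (i, True)) (rev [k..<Suc m])) = descent m k"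
  proof (induction m)
    case (Suc m)
    then show ?case by (simp add: braid_eval_def)
  qed (use assms in simp)
  show "map (\<lambda>i. (i, True)) (rev [k..<Suc m]) \<in> braid_words (Suc m)"
    using assms by (auto simp: braid_words_def)
qed

lemma t_braid_eval:
  assumes "x \<in> braid_words n" "n < j"
  shows "YH_cong q d (gen_t j * braid_eval q d x) (braid_eval q d x * gen_t j)"
  using assms(1)
proof (induction x rule: rev_induct)
  case (snoc l x)
  obtain i s where l: "l = (i, s)" by (cases l)
  have i: "1 \<le> i" "i < n" and x: "x \<in> braid_words n" using snoc.prems l by auto
  have g: "YH_cong q d (gen_t j * gen_g i) (gen_g i * gen_t j)"
    using cong_t_g[of i j q d] i assms by (simp add: Transposition.transpose_def)
  have e: "YH_cong q d (idem_e d i * gen_t j) (gen_t j * idem_e d i)"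
    unfolding idem_e_def
    using i assms(2) by (intro YH_cong_swap_scalar YH_cong_commute_sum YH_cong_swap YH_cong_swap_power cong_t_commute) auto
  have "YH_cong q d (gen_t j * g_inverse q d i) (g_inverse q d i * gen_t j)"
    unfolding g_inverse_def left_diff_distrib right_diff_distrib scalar_left_commute[of "gen_t j"] mult.assoc
    by (intro YH_cong_diff g YH_cong_lmult YH_cong_sym[OF e])
  with g have l_comm: "YH_cong q d (gen_t j * braid_eval q d [l]) (braid_eval q d [l] * gen_t j)"
    using l by simp
  have "YH_cong q d (gen_t j * braid_eval q d x * braid_eval q d [l])
      (braid_eval q d x * gen_t j * braid_eval q d [l])"
    by (intro YH_cong_rmult snoc.IH x)
  moreover have "YH_cong q d (braid_eval q d x * gen_t j * braid_eval q d [l])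
      (braid_eval q d x * (braid_eval q d [l] * gen_t j))"
    unfolding mult.assoc by (intro YH_cong_lmult l_comm)
  ultimately show ?case
    unfolding braid_eval_simps(2) mult.assoc by (rule YH_cong_trans)
qed simp

context markov_trace
begin

lemma trace_zero: "\<tau> 0 = 0"
  using trace_scalar[of 0 0] by simp

lemma trace_sum: "\<tau> (sum f I) = (\<Sum>i\<in>I. \<tau> (f i))"
  by (induction I rule: infinite_finite_induct) (simp_all add: trace_zero trace_add)

lemma finite_D: "finite D" and D_nonempty: "D \<noteq> {}" and D_less: "m \<in> D \<Longrightarrow> m < d"
  using D unfolding residue_subset_def by (auto intro: finite_subset)

lemma card_D_pos: "card D > 0"
  using finite_D D_nonempty by (simp add: card_gt_0_iff)

lemma trace_t': "a \<in> A n \<Longrightarrow> k < d \<Longrightarrow>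
    \<tau> (a * gen_t (Suc n) ^ k) = Polynomial.smult (E_solution d D k) (\<tau> a)"
  using trace_t[of a n k] card_D_pos by (cases k) (auto simp: E_solution_def)

text \<open>
  The values of the trace on the powers of \<open>gen_t (Suc n)\<close> are the Fourier transform of the uniform
  distribution on \<open>D\<close>; this lemma is the inverse transform.
\<close>

lemma trace_eigenproj:
  assumes "a \<in> A n" "m < d"
  shows "\<tau> (a * eigenproj d m (Suc n)) =
    Polynomial.smult (if m \<in> D then 1 / of_nat (card D) else 0) (\<tau> a)"
proof -
  let ?z = "\<lambda>s. inverse (zeta d) ^ (m * s)"
  have expand: "a * eigenproj d m (Suc n) =
      scalar (1 / of_nat d) * (\<Sum>s<d. scalar (?z s) * (a * gen_t (Suc n) ^ s))"
    unfolding eigenproj_def by (simp only: scalar_left_commute[of a] sum_distrib_left[of a])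
  have "\<tau> (a * eigenproj d m (Suc n)) =
      Polynomial.smult (1 / of_nat d) (\<Sum>s<d. Polynomial.smult (?z s) (Polynomial.smult (E_solution d D s) (\<tau> a)))"
    unfolding expand trace_scalar trace_sum by (simp add: trace_t'[OF assms(1)])
  also have "\<dots> = Polynomial.smult (1 / of_nat d * (\<Sum>s<d. ?z s * E_solution d D s)) (\<tau> a)"
    by (simp add: smult_sum[symmetric])
  also have "(\<Sum>s<d. ?z s * E_solution d D s) =
      1 / of_nat (card D) * (\<Sum>m'\<in>D. \<Sum>s<d. ?z s * zeta d ^ (m' * s))"
    unfolding E_solution_zeta by (subst sum.swap) (simp add: sum_distrib_left sum_distrib_right mult_ac)
  also have "(\<Sum>m'\<in>D. \<Sum>s<d. ?z s * zeta d ^ (m' * s)) = (\<Sum>m'\<in>D. if m = m' then of_nat d else 0)"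
    using assms(2) D_less by (intro sum.cong refl zeta_orthogonality)
  also have "\<dots> = (if m \<in> D then of_nat d else 0)"
    using finite_D by simp
  finally show ?thesis
    using d_pos by simp
qed

text \<open>
  The eigenprojection of the last strand is brought to the front by the trace property. It then
  travels through the braid, follows the last strand along the descent to position \<open>k\<close>, and meets the
  colour that is already there. What remains contains \<open>gen_g n\<close> once.
\<close>

lemma trace_coloured_descent:
  assumes x: "x \<in> braid_words n" and k: "1 \<le> k" "k \<le> n"
    and \<kappa>: "\<And>j. j \<in> {1..Suc n} \<Longrightarrow> \<kappa> j < d"
  shows "\<tau> (braid_eval q d x * descent n k * colour_proj d (Suc n) \<kappa>) =
    (if \<kappa> k = \<kappa> (Suc n)
     then [:0, 1:] * \<tau> (braid_eval q d x * descent (n - 1) k * colour_proj d n \<kappa>) else 0)"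
proof -
  obtain m where m: "n = Suc m" using k by (cases n) auto
  obtain y where y: "y \<in> braid_words n" "braid_eval q d y = descent m k"
    using descent_word[of k m] k m by blast
  let ?X = "braid_eval q d x" and ?C = "descent n k" and ?P = "colour_proj d n \<kappa>"
  let ?e = "\<lambda>j. eigenproj d (\<kappa> (Suc n)) j"
  have X: "YH_cong q d (?e (Suc n) * ?X) (?X * ?e (Suc n))"
    using x by (intro eigenproj_swap t_braid_eval) auto
  have C: "YH_cong q d (?e (Suc n) * ?C) (?C * ?e k)"
    using k by (intro eigenproj_swap t_descent) auto
  have P: "YH_cong q d (?e k * ?P) (if \<kappa> k = \<kappa> (Suc n) then ?P else 0)"
    using k \<kappa> by (intro eigenproj_colour_proj) auto
  have "\<tau> (?X * ?C * colour_proj d (Suc n) \<kappa>) = \<tau> (?e (Suc n) * ?X * (?C * ?P))"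
    using trace_commute[of "?X * ?C * ?P" "?e (Suc n)"] by (simp add: mult.assoc)
  also have "\<dots> = \<tau> (?X * ?e (Suc n) * (?C * ?P))"
    by (intro trace_cong YH_cong_rmult X)
  also have "\<dots> = \<tau> (?X * (?e (Suc n) * ?C * ?P))"
    by (simp only: mult.assoc)
  also have "\<dots> = \<tau> (?X * (?C * ?e k * ?P))"
    by (intro trace_cong YH_cong_lmult YH_cong_rmult C)
  also have "\<dots> = \<tau> (?X * ?C * (?e k * ?P))"
    by (simp only: mult.assoc)
  also have "\<dots> = \<tau> (?X * ?C * (if \<kappa> k = \<kappa> (Suc n) then ?P else 0))"
    by (intro trace_cong YH_cong_lmult P)
  also have "\<dots> = (if \<kappa> k = \<kappa> (Suc n) then \<tau> (?X * ?C * ?P) else 0)"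
    by (simp add: trace_zero)
  also have "\<tau> (?X * ?C * ?P) = \<tau> (descent m k * ?P * ?X * gen_g n)"
    using trace_commute[of "?X * gen_g n" "descent m k * ?P"] k m by (simp add: mult.assoc)
  also have "\<dots> = [:0, 1:] * \<tau> (descent m k * ?P * ?X)"
    using braid_eval_A[OF x] braid_eval_A[OF y(1), of q d] y(2) m by (intro trace_g A_mult) auto
  also have "\<tau> (descent m k * ?P * ?X) = \<tau> (?X * descent m k * ?P)"
    using trace_commute[of "descent m k * ?P" ?X] by (simp add: mult.assoc)
  finally show ?thesis using m by simp
qed

end

text \<open>
  The trace of the family vanishes on colourings that leave \<open>D\<close>. On colourings with values in \<open>D\<close> it is
  one polynomial \<open>v\<close>, which depends on the pattern \<open>R\<close> and on the cardinality \<open>N\<close> of \<open>D\<close> only.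
\<close>

definition determined ::
  "complex \<Rightarrow> nat \<Rightarrow> nat \<Rightarrow> (nat \<Rightarrow> (nat \<Rightarrow> nat) \<Rightarrow> free_alg) \<Rightarrow> (nat \<Rightarrow> nat \<Rightarrow> bool) \<Rightarrow> bool" where
  "determined q N n f R \<longleftrightarrow> (\<exists>v. \<forall>d D \<tau> \<kappa>. markov_trace q d D \<tau> \<longrightarrow> card D = N \<longrightarrow>
     coloured d n R \<kappa> \<longrightarrow> \<tau> (f d \<kappa>) = (if \<kappa> ` {1..n} \<subseteq> D then v else 0))"

lemma determinedI:
  assumes "\<And>d D \<tau> \<kappa>. \<lbrakk>markov_trace q d D \<tau>; card D = N; coloured d n R \<kappa>\<rbrakk> \<Longrightarrow>
     \<tau> (f d \<kappa>) = (if \<kappa> ` {1..n} \<subseteq> D then v else 0)"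
  shows "determined q N n f R"
  using assms unfolding determined_def by blast

lemma determinedE:
  assumes "determined q N n f R"
  obtains v where "\<And>d D \<tau> \<kappa>. \<lbrakk>markov_trace q d D \<tau>; card D = N; coloured d n R \<kappa>\<rbrakk> \<Longrightarrow>
     \<tau> (f d \<kappa>) = (if \<kappa> ` {1..n} \<subseteq> D then v else 0)"
  using assms unfolding determined_def by blast

lemma coloured_Suc: "coloured d (Suc n) R \<kappa> \<Longrightarrow> coloured d n R \<kappa>"
  by (auto simp: coloured_def)

lemma image_atLeastAtMost_Suc: "\<kappa> ` {1..Suc n} \<subseteq> D \<longleftrightarrow> \<kappa> ` {1..n} \<subseteq> D \<and> \<kappa> (Suc n) \<in> D"
proof -
  have "{1..Suc n} = insert (Suc n) {1..n}" by auto
  then show ?thesis by auto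
qed

text \<open>
  Both trace rules keep the property. Removing a last strand with the trivial coset contributes
  \<open>1 / N\<close> or \<open>0\<close>, according to whether its colour lies in \<open>D\<close>. Otherwise the contribution is \<open>z\<close> if the
  last strand and strand \<open>k\<close> have the same colour and \<open>0\<close> if not, which the pattern decides.
\<close>

lemma reducible_imp_determined:
  assumes red: "reducible q n R f"
    and IH: "\<And>w. w \<in> braid_words n \<Longrightarrow>
      determined q N n (\<lambda>d \<kappa>. braid_eval q d w * colour_proj d n \<kappa>) R"
  shows "determined q N (Suc n) f R"
  using red
proof (induction rule: reducible.induct)
  case (normal x k)
  show ?case
  proof (cases "k = Suc n")
    case True
    from IH[OF normal(1)] obtain v where
      v: "\<And>d D \<tau> \<kappa>. \<lbrakk>markov_trace q d D \<tau>; card D = N; coloured d n R \<kappa>\<rbrakk> \<Longrightarrow>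
        \<tau> (braid_eval q d x * colour_proj d n \<kappa>) = (if \<kappa> ` {1..n} \<subseteq> D then v else 0)"
      by (rule determinedE) blast
    show ?thesis
    proof (rule determinedI[where v = "Polynomial.smult (1 / of_nat N) v"])
      fix d D \<tau> \<kappa>
      assume \<tau>: "markov_trace q d D \<tau>" and N: "card D = N" and col: "coloured d (Suc n) R \<kappa>"
      interpret markov_trace q d D \<tau> by fact
      have "\<tau> (braid_eval q d x * colour_proj d n \<kappa> * eigenproj d (\<kappa> (Suc n)) (Suc n)) =
          Polynomial.smult (if \<kappa> (Suc n) \<in> D then 1 / of_nat (card D) else 0)
            (\<tau> (braid_eval q d x * colour_proj d n \<kappa>))"
        using col braid_eval_A[OF normal(1)] by (intro trace_eigenproj A_mult) (auto simp: coloured_def)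
      then show "\<tau> (braid_eval q d x * descent n k * colour_proj d (Suc n) \<kappa>) =
          (if \<kappa> ` {1..Suc n} \<subseteq> D then Polynomial.smult (1 / of_nat N) v else 0)"
        unfolding image_atLeastAtMost_Suc
        using v[OF \<tau> N coloured_Suc[OF col]] N True by (simp add: mult.assoc)
    qed
  next
    case False
    then have k: "1 \<le> k" "k \<le> n" using normal by simp_all
    then obtain y where y: "y \<in> braid_words n" "\<And>q d. braid_eval q d y = descent (n - 1) k"
      using descent_word[of k "n - 1"] by auto
    have xy: "x @ y \<in> braid_words n" using normal y by simp
    from IH[OF xy] obtain v where
      v: "\<And>d D \<tau> \<kappa>. \<lbrakk>markov_trace q d D \<tau>; card D = N; coloured d n R \<kappa>\<rbrakk> \<Longrightarrow>
        \<tau> (braid_eval q d (x @ y) * colour_proj d n \<kappa>) = (if \<kappa> ` {1..n} \<subseteq> D then v else 0)"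
      by (rule determinedE) blast
    show ?thesis
    proof (rule determinedI[where v = "if R k (Suc n) then [:0, 1:] * v else 0"])
      fix d D \<tau> \<kappa>
      assume \<tau>: "markov_trace q d D \<tau>" and N: "card D = N" and col: "coloured d (Suc n) R \<kappa>"
      interpret markov_trace q d D \<tau> by fact
      have eq: "\<kappa> k = \<kappa> (Suc n) \<longleftrightarrow> R k (Suc n)"
        using col k by (auto simp: coloured_def)
      have "\<kappa> (Suc n) \<in> D" if "R k (Suc n)" "\<kappa> ` {1..n} \<subseteq> D"
      proof -
        have "\<kappa> k \<in> D" using that k by auto
        then show ?thesis using that eq by simp
      qed
      moreover have "\<tau> (braid_eval q d x * descent n k * colour_proj d (Suc n) \<kappa>) =
          (if \<kappa> k = \<kappa> (Suc n)
           then [:0, 1:] * \<tau> (braid_eval q d x * descent (n - 1) k * colour_proj d n \<kappa>) else 0)"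
        using col by (intro trace_coloured_descent normal(1) k) (auto simp: coloured_def)
      ultimately show "\<tau> (braid_eval q d x * descent n k * colour_proj d (Suc n) \<kappa>) =
          (if \<kappa> ` {1..Suc n} \<subseteq> D then if R k (Suc n) then [:0, 1:] * v else 0 else 0)"
        unfolding image_atLeastAtMost_Suc
        using v[OF \<tau> N coloured_Suc[OF col]] eq by (auto simp: y(2) simp del: mult_pCons_left)
    qed
  qed
next
  case (add f h)
  from add.IH(1) obtain v where
    v: "\<And>d D \<tau> \<kappa>. \<lbrakk>markov_trace q d D \<tau>; card D = N; coloured d (Suc n) R \<kappa>\<rbrakk> \<Longrightarrow>
      \<tau> (f d \<kappa>) = (if \<kappa> ` {1..Suc n} \<subseteq> D then v else 0)"
    by (rule determinedE) blast
  from add.IH(2) obtain v' where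
    v': "\<And>d D \<tau> \<kappa>. \<lbrakk>markov_trace q d D \<tau>; card D = N; coloured d (Suc n) R \<kappa>\<rbrakk> \<Longrightarrow>
      \<tau> (h d \<kappa>) = (if \<kappa> ` {1..Suc n} \<subseteq> D then v' else 0)"
    by (rule determinedE) blast
  show ?case
    by (rule determinedI[where v = "v + v'"]) (simp add: markov_trace.trace_add v v')
next
  case (scale f c)
  from scale.IH obtain v where
    v: "\<And>d D \<tau> \<kappa>. \<lbrakk>markov_trace q d D \<tau>; card D = N; coloured d (Suc n) R \<kappa>\<rbrakk> \<Longrightarrow>
      \<tau> (f d \<kappa>) = (if \<kappa> ` {1..Suc n} \<subseteq> D then v else 0)"
    by (rule determinedE) blast
  show ?case
    by (rule determinedI[where v = "Polynomial.smult c v"]) (simp add: markov_trace.trace_scalar v)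
next
  case (cong f h)
  from cong.IH obtain v where
    v: "\<And>d D \<tau> \<kappa>. \<lbrakk>markov_trace q d D \<tau>; card D = N; coloured d (Suc n) R \<kappa>\<rbrakk> \<Longrightarrow>
      \<tau> (f d \<kappa>) = (if \<kappa> ` {1..Suc n} \<subseteq> D then v else 0)"
    by (rule determinedE) blast
  show ?case
    by (rule determinedI[where v = v])
      (metis cong.hyps(2) markov_trace.trace_cong v)
qed

lemma braid_determined:
  "w \<in> braid_words n \<Longrightarrow> determined q N n (\<lambda>d \<kappa>. braid_eval q d w * colour_proj d n \<kappa>) R"
proof (induction n arbitrary: w)
  case 0
  have "w = []" using 0 by (cases w) auto
  then show ?case
    by (intro determinedI[where v = 1]) (simp add: markov_trace.trace_one)
next
  case (Suc n)
  show ?case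
    by (rule reducible_imp_determined[OF reducible_braid[OF Suc.prems] Suc.IH])
qed

text \<open>
  The colourings that leave \<open>D\<close> contribute nothing, and a bijection between \<open>D\<close> and \<open>D'\<close> matches the
  remaining ones so that patterns are preserved.
\<close>

lemma sum_coloured_trace_eq:
  assumes \<tau>: "markov_trace q d D \<tau>" and \<tau>': "markov_trace q d' D' \<tau>'"
    and card: "card D = N" "card D' = N"
    and det: "\<And>R. determined q N n f R"
  shows "(\<Sum>\<kappa>\<in>{1..n} \<rightarrow>\<^sub>E {..<d}. \<tau> (f d \<kappa>)) = (\<Sum>\<kappa>\<in>{1..n} \<rightarrow>\<^sub>E {..<d'}. \<tau>' (f d' \<kappa>))"
proof -
  have only_D: "(\<Sum>\<kappa>\<in>{1..n} \<rightarrow>\<^sub>E {..<d}. \<tau> (f d \<kappa>)) = (\<Sum>\<kappa>\<in>{1..n} \<rightarrow>\<^sub>E D. \<tau> (f d \<kappa>))"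
    if \<tau>: "markov_trace q d D \<tau>" and N: "card D = N" for d D \<tau>
  proof (rule sum.mono_neutral_right)
    interpret markov_trace q d D \<tau> by fact
    show "{1..n} \<rightarrow>\<^sub>E D \<subseteq> {1..n} \<rightarrow>\<^sub>E {..<d}"
      using D_less by (intro PiE_mono) auto
    show "\<forall>\<kappa>\<in>({1..n} \<rightarrow>\<^sub>E {..<d}) - ({1..n} \<rightarrow>\<^sub>E D). \<tau> (f d \<kappa>) = 0"
    proof
      fix \<kappa> assume \<kappa>: "\<kappa> \<in> ({1..n} \<rightarrow>\<^sub>E {..<d}) - ({1..n} \<rightarrow>\<^sub>E D)"
      then have "\<not> \<kappa> ` {1..n} \<subseteq> D" by (auto simp: PiE_def)
      moreover have col: "coloured d n (\<lambda>i j. \<kappa> i = \<kappa> j) \<kappa>"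
        using \<kappa> by (auto simp: coloured_def PiE_def Pi_def)
      obtain v where "\<tau> (f d \<kappa>) = (if \<kappa> ` {1..n} \<subseteq> D then v else 0)"
        by (rule determinedE[OF det[of "\<lambda>i j. \<kappa> i = \<kappa> j"]]) (use \<tau> N col in blast)
      ultimately show "\<tau> (f d \<kappa>) = 0" by simp
    qed
  qed (auto intro: finite_PiE)
  interpret L: markov_trace q d D \<tau> by fact
  interpret R: markov_trace q d' D' \<tau>' by fact
  obtain \<phi> where \<phi>: "bij_betw \<phi> D D'"
    using finite_same_card_bij[OF L.finite_D R.finite_D] card by auto
  have "(\<Sum>\<kappa>\<in>{1..n} \<rightarrow>\<^sub>E D. \<tau> (f d \<kappa>)) = (\<Sum>\<kappa>\<in>{1..n} \<rightarrow>\<^sub>E D'. \<tau>' (f d' \<kappa>))"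
  proof (rule sum.reindex_bij_witness[of _ "\<lambda>\<kappa>. \<lambda>j\<in>{1..n}. inv_into D \<phi> (\<kappa> j)" "\<lambda>\<kappa>. \<lambda>j\<in>{1..n}. \<phi> (\<kappa> j)"])
    fix \<kappa> assume \<kappa>: "\<kappa> \<in> {1..n} \<rightarrow>\<^sub>E D"
    then have in_D: "\<kappa> j \<in> D" if "j \<in> {1..n}" for j using that by auto
    let ?\<kappa>' = "\<lambda>j\<in>{1..n}. \<phi> (\<kappa> j)"
    show "(\<lambda>j\<in>{1..n}. inv_into D \<phi> (?\<kappa>' j)) = \<kappa>"
      using \<kappa> in_D \<phi> by (auto simp: fun_eq_iff bij_betw_def inv_into_f_f PiE_def extensional_def)
    show \<kappa>': "?\<kappa>' \<in> {1..n} \<rightarrow>\<^sub>E D'"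
      using in_D \<phi> by (auto simp: bij_betw_def)
    obtain v where v: "\<And>d D \<tau> \<kappa>'. \<lbrakk>markov_trace q d D \<tau>; card D = N; coloured d n (\<lambda>i j. \<kappa> i = \<kappa> j) \<kappa>'\<rbrakk> \<Longrightarrow>
        \<tau> (f d \<kappa>') = (if \<kappa>' ` {1..n} \<subseteq> D then v else 0)"
      by (rule determinedE[OF det]) blast
    have "coloured d n (\<lambda>i j. \<kappa> i = \<kappa> j) \<kappa>"
      using in_D L.D_less by (auto simp: coloured_def)
    moreover have "coloured d' n (\<lambda>i j. \<kappa> i = \<kappa> j) ?\<kappa>'"
      using in_D \<phi> R.D_less by (auto simp: coloured_def bij_betw_def inj_on_def)
    moreover have "\<kappa> ` {1..n} \<subseteq> D" "?\<kappa>' ` {1..n} \<subseteq> D'"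
      using in_D \<kappa>' by auto
    ultimately show "\<tau>' (f d' ?\<kappa>') = \<tau> (f d \<kappa>)"
      using v[OF \<tau> card(1)] v[OF \<tau>' card(2)] by simp
  next
    fix \<kappa> assume \<kappa>: "\<kappa> \<in> {1..n} \<rightarrow>\<^sub>E D'"
    then have in_D: "\<kappa> j \<in> \<phi> ` D" if "j \<in> {1..n}" for j using that \<phi> by (auto simp: bij_betw_def)
    show "(\<lambda>j\<in>{1..n}. \<phi> ((\<lambda>j\<in>{1..n}. inv_into D \<phi> (\<kappa> j)) j)) = \<kappa>"
      using \<kappa> in_D by (auto simp: fun_eq_iff f_inv_into_f PiE_def extensional_def)
    show "(\<lambda>j\<in>{1..n}. inv_into D \<phi> (\<kappa> j)) \<in> {1..n} \<rightarrow>\<^sub>E D"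
      using in_D by (auto intro: inv_into_into)
  qed
  then show ?thesis
    using only_D[OF \<tau> card(1)] only_D[OF \<tau>' card(2)] by simp
qed

lemma (in markov_trace) trace_sum_colourings:
  "\<tau> a = (\<Sum>\<kappa>\<in>{1..n} \<rightarrow>\<^sub>E {..<d}. \<tau> (a * colour_proj d n \<kappa>))"
  using sum_colour_proj[OF d_pos, of n] by (simp flip: trace_sum sum_distrib_left)

lemma trace_eq_via_colourings:
  assumes \<tau>: "markov_trace q d D \<tau>" and \<tau>': "markov_trace q d' D' \<tau>'" and card: "card D = card D'"
    and det: "\<And>R. determined q (card D') n (\<lambda>d \<kappa>. a d * colour_proj d n \<kappa>) R"
  shows "\<tau> (a d) = \<tau>' (a d')"
  using sum_coloured_trace_eq[OF \<tau> \<tau>' card refl det]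
    markov_trace.trace_sum_colourings[OF \<tau>, of "a d" n]
    markov_trace.trace_sum_colourings[OF \<tau>', of "a d'" n]
  by argo

lemma trace_braid_eq:
  assumes "markov_trace q d D \<tau>" "markov_trace q d' D' \<tau>'" "card D = card D'" "w \<in> braid_words n"
  shows "\<tau> (braid_eval q d w) = \<tau>' (braid_eval q d' w)"
  by (rule trace_eq_via_colourings[OF assms(1-3)]) (rule braid_determined[OF assms(4)])

text \<open>
  The common value is \<open>1 / card D\<close>. It need not be computed, because on coloured elements the
  idempotent is a scalar given by the pattern, hence reducible.
\<close>

lemma trace_idem_e_eq:
  assumes "markov_trace q d D \<tau>" "markov_trace q d' D' \<tau>'" "card D = card D'"
  shows "\<tau> (idem_e d 1) = \<tau>' (idem_e d' 1)"
proof (rule trace_eq_via_colourings[OF assms])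
  fix R
  have "reducible q 1 R (\<lambda>d \<kappa>. idem_e d 1 * colour_proj d (Suc 1) \<kappa>)"
  proof (rule reducible.cong)
    show "reducible q 1 R (\<lambda>d \<kappa>. scalar (if R 1 2 then 1 else 0) *
        (braid_eval q d [] * descent 1 2 * colour_proj d (Suc 1) \<kappa>))"
      by (intro reducible.scale reducible.normal) auto
    fix d \<kappa> assume "coloured d (Suc 1) R \<kappa>"
    then have col: "\<kappa> 1 < d" "\<kappa> 2 < d" "\<kappa> 1 = \<kappa> 2 \<longleftrightarrow> R 1 2"
      by (auto simp: coloured_def)
    then show "YH_cong q d (scalar (if R 1 2 then 1 else 0) *
        (braid_eval q d [] * descent 1 2 * colour_proj d (Suc 1) \<kappa>))
        (idem_e d 1 * colour_proj d (Suc 1) \<kappa>)"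
      using YH_cong_sym[OF idem_e_colour_proj[of 1 "Suc 1" \<kappa> d q]]
      by (simp del: colour_proj.simps add: numeral_2_eq_2 split: if_splits)
  qed
  then have "determined q (card D') (Suc 1) (\<lambda>d \<kappa>. idem_e d 1 * colour_proj d (Suc 1) \<kappa>) R"
    by (rule reducible_imp_determined) (rule braid_determined)
  then show "determined q (card D') 2 (\<lambda>d \<kappa>. idem_e d 1 * colour_proj d 2 \<kappa>) R"
    by (simp only: Suc_1)
qed

section \<open>The invariants\<close>

text \<open>
  By compatibility with the inclusions any level containing the element gives the same value; the
  least one is a canonical choice.
\<close>

definition stable_trace ::
  "complex \<Rightarrow> nat \<Rightarrow> (nat \<Rightarrow> free_alg set \<Rightarrow> complex poly) \<Rightarrow> free_alg \<Rightarrow> complex poly" where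
  "stable_trace q d tr a =
     (let n = LEAST n. proper a \<in> A n in tr n (YH_class q d n (proper a)))"

context
  fixes q d D tr
  assumes spec: "is_specialized_trace q d D tr"
begin

lemma spec_level:
  assumes "a \<in> A m" "m \<le> n"
  shows "tr n (YH_class q d n a) = tr m (YH_class q d m a)"
  using assms(2)
proof (induction rule: dec_induct)
  case (step n)
  have "a \<in> A n" using A_mono[OF step(1) assms(1)] .
  then show ?case using step spec unfolding is_specialized_trace_def by simp
qed simp

lemma stable_trace_level:
  assumes "proper a \<in> A n"
  shows "stable_trace q d tr a = tr n (YH_class q d n (proper a))"
  unfolding stable_trace_def Let_def
  by (rule spec_level[symmetric]) (rule LeastI[where P = "\<lambda>n. proper a \<in> A n", OF assms], rule Least_le[where P = "\<lambda>n. proper a \<in> A n", OF assms])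

lemma proper_in_common_A:
  obtains n where "proper a \<in> A n" "proper b \<in> A n"
proof -
  obtain k l where "proper a \<in> A k" "proper b \<in> A l" using proper_in_A by blast
  then have "proper a \<in> A (max k l)" "proper b \<in> A (max k l)"
    using A_mono[of k "max k l"] A_mono[of l "max k l"] by simp_all
  then show ?thesis using that by blast
qed

lemma markov_trace_stable:
  assumes "0 < d" "residue_subset d D"
  shows "markov_trace q d D (stable_trace q d tr)"
proof
  show "0 < d" "residue_subset d D" by fact+
next
  fix a b
  obtain n where n: "proper a \<in> A n" "proper b \<in> A n" by (rule proper_in_common_A)
  show "stable_trace q d tr (a + b) = stable_trace q d tr a + stable_trace q d tr b"
    using n spec stable_trace_level[of _ n] unfolding is_specialized_trace_def
    by (simp add: proper_add)
  show "stable_trace q d tr (a * b) = stable_trace q d tr (b * a)"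
    using n spec stable_trace_level[of _ n] unfolding is_specialized_trace_def
    by (simp add: proper_mult)
next
  fix c a
  obtain n where n: "proper a \<in> A n" using proper_in_A by blast
  have "proper (scalar c) = scalar c" using scalar_A proper_on_A by blast
  then show "stable_trace q d tr (scalar c * a) = Polynomial.smult c (stable_trace q d tr a)"
    using n spec stable_trace_level[of _ n] unfolding is_specialized_trace_def
    by (simp add: proper_mult)
next
  show "stable_trace q d tr 1 = 1"
    using spec stable_trace_level[of 1 0] proper_on_A[OF A_1[of 0]] unfolding is_specialized_trace_def
    by simp
next
  fix n a
  assume n: "1 \<le> n" and a: "a \<in> A n"
  have "a * gen_g n \<in> A (n + 1)" using n A_mono[OF _ a, of "n + 1"] by (intro A_mult) auto
  then show "stable_trace q d tr (a * gen_g n) = [:0, 1:] * stable_trace q d tr a"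
    using n a spec stable_trace_level[of "a * gen_g n" "n + 1"] stable_trace_level[of a n]
    unfolding is_specialized_trace_def by simp
next
  fix n a k
  assume a: "a \<in> A n" and k: "k \<in> {1..<d}"
  have "a * gen_t (n + 1) ^ k \<in> A (n + 1)" using A_mono[OF _ a, of "n + 1"] by (intro A_mult A_power) auto
  then show "stable_trace q d tr (a * gen_t (n + 1) ^ k) =
      Polynomial.smult (E_solution d D k) (stable_trace q d tr a)"
    using a k spec stable_trace_level[of "a * gen_t (n + 1) ^ k" "n + 1"] stable_trace_level[of a n]
    unfolding is_specialized_trace_def by simp
next
  fix a b
  assume "YH_cong q d a b"
  then obtain m where m: "proper (a - b) \<in> YH_ideal q d m" unfolding YH_cong_def by blast
  obtain n where n: "proper a \<in> A n" "proper b \<in> A n" by (rule proper_in_common_A)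
  let ?N = "max m n"
  have "proper a - proper b \<in> YH_ideal q d ?N"
    using m subsetD[OF YH_ideal_mono[of m ?N]] by (simp add: proper_diff)
  moreover have N: "proper a \<in> A ?N" "proper b \<in> A ?N"
    using n A_mono[of n ?N] by simp_all
  ultimately have "YH_class q d ?N (proper a) = YH_class q d ?N (proper b)"
    by (intro YH_class_eq)
  then show "stable_trace q d tr a = stable_trace q d tr b"
    using stable_trace_level N by simp
qed

end

lemma braid_image_eq:
  "w \<in> braid_words n \<Longrightarrow> braid_image q d n w = YH_class q d n (braid_eval q d w)"
proof (induction w)
  case Nil
  then show ?case by (simp add: YH_class_one)
next
  case (Cons l w)
  obtain i s where l: "l = (i, s)" by (cases l)
  have i: "i \<in> {1..<n}" and w: "w \<in> braid_words n" using Cons.prems l by auto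
  have "braid_eval q d (l # w) = (if s then gen_g i else g_inverse q d i) * braid_eval q d w"
    using l by (simp add: braid_eval_def)
  then show ?case
    using i w braid_eval_A[OF w] Cons.IH[OF w] inv_YH_class_gen_g[OF i] l
    by (simp add: YH_class_mult)
qed

lemma braid_group_word: "\<alpha> \<in> carrier (braid_group n) \<Longrightarrow> w \<in> \<alpha> \<Longrightarrow> w \<in> braid_words n"
  by (auto simp: braid_group_def braid_rel_def quotient_def)

context
  fixes q :: complex
    and rt :: "complex poly fract alg_closure \<Rightarrow> complex poly fract alg_closure"
    and tr :: "nat \<Rightarrow> nat set \<Rightarrow> nat \<Rightarrow> free_alg set \<Rightarrow> complex poly"
  assumes tr: "\<And>d D. \<lbrakk>0 < d; residue_subset d D\<rbrakk> \<Longrightarrow> is_specialized_trace q d D (tr d D)"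
begin

lemma trace_braid_image_eq:
  assumes "0 < d" "residue_subset d D" "0 < d'" "residue_subset d' D'" "card D = card D'"
    and w: "w \<in> braid_words n"
  shows "tr d D n (braid_image q d n w) = tr d' D' n (braid_image q d' n w)"
proof -
  have level: "tr d D n (braid_image q d n w) = stable_trace q d (tr d D) (braid_eval q d w)"
    if "0 < d" "residue_subset d D" for d D
    using stable_trace_level[OF tr[OF that], of "braid_eval q d w" n] braid_eval_A[OF w]
      proper_on_A[OF braid_eval_A[OF w]]
    by (simp add: braid_image_eq[OF w])
  show ?thesis
    using trace_braid_eq[OF markov_trace_stable[OF tr] markov_trace_stable[OF tr]] assms level
    by metis
qed

lemma E_trace_eq:
  assumes "0 < d" "residue_subset d D" "0 < d'" "residue_subset d' D'" "card D = card D'"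
  shows "E_trace q tr d D = E_trace q tr d' D'"
proof -
  have level: "E_trace q tr d D = stable_trace q d (tr d D) (idem_e d 1)"
    if "0 < d" "residue_subset d D" for d D
    using stable_trace_level[OF tr[OF that], of "idem_e d 1" 2] proper_on_A[OF idem_e_A[of 1 2 d]]
    by (simp add: E_trace_def)
  show ?thesis
    using trace_idem_e_eq[OF markov_trace_stable[OF tr] markov_trace_stable[OF tr]] assms level
    by metis
qed

text \<open>
  The expressions for the invariants agree for every braid word, so the two descriptions of the value
  at a link coincide.
\<close>

lemma Theta_eq:
  assumes "0 < d" "residue_subset d D" "0 < d'" "residue_subset d' D'" "card D = card D'"
  shows "Theta q rt tr d D = Theta q rt tr d' D'"
proof -
  have lam: "lam q tr d D = lam q tr d' D'"
    unfolding lam_def E_trace_eq[OF assms] ..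
  have "Theta_braid q rt tr d D n w = Theta_braid q rt tr d' D' n w" if "w \<in> braid_words n" for n w
    unfolding Theta_braid_def Lam_def lam trace_braid_image_eq[OF assms that] ..
  then show ?thesis
    unfolding Theta_def using braid_group_word
    by (intro restrict_ext arg_cong[where f = The] ext) metis
qed

lemma Theta_eq_Theta_full:
  assumes "0 < d" "residue_subset d D"
  shows "Theta q rt tr d D = Theta_full q rt tr (card D)"
proof -
  have "0 < card D"
    using assms by (auto simp: residue_subset_def card_gt_0_iff intro: finite_subset)
  then show ?thesis
    unfolding Theta_full_def using assms by (intro Theta_eq) (auto simp: residue_subset_def)
qed

end

lemma residue_subset_card: "residue_subset d D \<Longrightarrow> card D \<in> {1..d}"
proof -
  assume D: "residue_subset d D"
  then have "finite D" by (auto simp: residue_subset_def intro: finite_subset)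
  with D show ?thesis
    using card_mono[of "{..<d}" D] by (auto simp: residue_subset_def card_gt_0_iff Suc_le_eq)
qed

theorem proposition4p6:
  fixes q :: complex
    and rt :: "complex poly fract alg_closure \<Rightarrow> complex poly fract alg_closure"
    and tr :: "nat \<Rightarrow> nat set \<Rightarrow> nat \<Rightarrow> free_alg set \<Rightarrow> complex poly"
  assumes q: "q \<noteq> 0"
    and rt: "\<And>x. rt x ^ 2 = x"
    and tr: "\<And>d D. \<lbrakk>0 < d; residue_subset d D\<rbrakk> \<Longrightarrow> is_specialized_trace q d D (tr d D)"
  shows
    "(\<forall>d>0. \<forall>D D'. residue_subset d D \<and> residue_subset d D' \<and> card D = card D' \<longrightarrow>
        Theta q rt tr d D = Theta q rt tr d D') \<and>
     (\<forall>d>0. finite {Theta q rt tr d D | D. residue_subset d D} \<and>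
        card {Theta q rt tr d D | D. residue_subset d D} \<le> d) \<and>
     (\<forall>d d' D D'. 0 < d \<and> d \<le> d' \<and> residue_subset d D \<and> residue_subset d' D' \<and>
        card D = card D' \<longrightarrow> Theta q rt tr d D = Theta q rt tr d' D') \<and>
     (\<forall>d d' D'. 0 < d \<and> d \<le> d' \<and> residue_subset d' D' \<and> card D' = d \<longrightarrow>
        Theta q rt tr d' D' = Theta_full q rt tr d) \<and>
     (\<forall>d>0. \<forall>D. residue_subset d D \<longrightarrow>
        Theta q rt tr d D = Theta_full q rt tr (card D)) \<and>
     {Theta q rt tr d D | d D. 0 < d \<and> residue_subset d D} =
        Theta_full q rt tr ` {d. 0 < d}"
proof -
  have full: "Theta q rt tr d D = Theta_full q rt tr (card D)"
    if "0 < d" "residue_subset d D" for d D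
    by (rule Theta_eq_Theta_full) (use tr that in auto)
  have few: "finite {Theta q rt tr d D | D. residue_subset d D} \<and>
      card {Theta q rt tr d D | D. residue_subset d D} \<le> d" if "0 < d" for d
  proof -
    have sub: "{Theta q rt tr d D | D. residue_subset d D} \<subseteq> Theta_full q rt tr ` {1..d}"
      using full[OF that] residue_subset_card by blast
    have "card (Theta_full q rt tr ` {1..d}) \<le> d"
      using card_image_le[of "{1..d}" "Theta_full q rt tr"] by simp
    then show ?thesis
      using sub finite_subset[OF sub] card_mono[OF _ sub] by fastforce
  qed
  have all: "{Theta q rt tr d D | d D. 0 < d \<and> residue_subset d D} = Theta_full q rt tr ` {d. 0 < d}"
  proof (intro equalityI subsetI)
    fix \<theta> assume "\<theta> \<in> {Theta q rt tr d D | d D. 0 < d \<and> residue_subset d D}"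
    then obtain d D where "0 < d" "residue_subset d D" "\<theta> = Theta q rt tr d D" by blast
    then show "\<theta> \<in> Theta_full q rt tr ` {d. 0 < d}"
      using full residue_subset_card[of d D] by auto
  next
    fix \<theta> assume "\<theta> \<in> Theta_full q rt tr ` {d. 0 < d}"
    then obtain d where "0 < d" "\<theta> = Theta q rt tr d {..<d}" unfolding Theta_full_def by blast
    moreover have "residue_subset d {..<d}" using \<open>0 < d\<close> by (auto simp: residue_subset_def)
    ultimately show "\<theta> \<in> {Theta q rt tr d D | d D. 0 < d \<and> residue_subset d D}" by blast
  qed
  show ?thesis
    by (intro conjI allI impI all; (elim conjE)?; simp add: full few)
qed

end
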